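(* Let $H$ be a connected graph and $B\in\ddot{\mathcal{S}}(H)$ with the strong spectral property (SSP) and $\operatorname{spec}(B)=\{\lambda_1,\lambda_2^{(m_2)},\ldots,\lambda_q^{(m_q)}\}$. Let $G$ be the graph obtained from the disjoint union $P_p\mathbin{\dot\cup}H$ by joining one endpoint of the path $P_p$ with all vertices of $H$, where $p\geq q-1$. Then there is a matrix $A'\in\ddot{\mathcal{S}}(G)$ with the SSP such that $$\operatorname{spec}(A')=\{\lambda_1,\lambda_2^{(m_2+1)},\ldots,\lambda_q^{(m_q+1)},\mu_1,\ldots,\mu_{p-q+1}\},$$ where $\lambda_i$'s and $\mu_i$'s are all distinct.
   Context: For a graph $G$ on $n$ vertices, $\ddot{\mathcal{S}}(G)$ is the set of discrete Schrödinger operators of $G$: the $n\times n$ real symmetric matrices (indexed by $V(G)$) whose off-diagonal $i,j$-entry is negative if $\{i,j\}$ is an edge and zero if it is not an edge, while diagonal entries can be any real numbers. $P_p$ is the path on $p$ vertices, and $\mathbin{\dot\cup}$ denotes disjoint union of graphs. The notation $\operatorname{spec}(A)=\{\lambda_1^{(m_1)},\ldots,\lambda_q^{(m_q)}\}$ means that the distinct eigenvalues of $A$ are $\lambda_1,\ldots,\lambda_q$ and $\lambda_i$ has multiplicity $m_i$; an eigenvalue written without a superscript has multiplicity one. A real symmetric matrix $A$ has the strong spectral property (SSP) if $X=O$ is the only real symmetric matrix that satisfies $A\circ X=O$, $I\circ X=O$, and $AX-XA=O$, where $\circ$ is the entrywise product, $I$ is the identity matrix and $O$ is the zero matrix.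
   Formalization: λ_1 is taken to be the smallest eigenvalue of B; for another simple eigenvalue the claim can fail, e.g. H = K_2, spec(B) = {1, 2}, λ_1 = 2, p = 1 would give a matrix of K_3 whose smallest eigenvalue is double. *)

theory Defs
  imports "HOL-Analysis.Analysis" "Graph_Theory.Graph_Theory"
begin

text \<open>
  A finite simple graph is a \<^locale>\<open>pair_graph\<close>: a finite, loop-free, symmetric set of arcs,
  an edge \<open>{i, j}\<close> being the two arcs \<open>(i, j)\<close> and \<open>(j, i)\<close>.  Matrices of a graph are indexed by
  its vertices, so graphs carrying matrices have the whole (finite) type as their vertex set.
\<close>

definition discrete_schrodinger :: "'v::finite pair_pre_digraph \<Rightarrow> (real^'v^'v) set" where
  "discrete_schrodinger G =
     {A. transpose A = A \<and>
         (\<forall>i j. i \<noteq> j \<longrightarrow> (if (i, j) \<in> parcs G then A $ i $ j < 0 else A $ i $ j = 0))}"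

text \<open>On \<open>real^'v^'v\<close>, \<open>*\<close> is the entrywise product and \<open>**\<close> the matrix product.\<close>

definition SSP :: "real^'v::finite^'v \<Rightarrow> bool" where
  "SSP A \<longleftrightarrow> transpose A = A \<and>
     (\<forall>X :: real^'v^'v. transpose X = X \<longrightarrow> A * X = 0 \<longrightarrow> mat 1 * X = 0 \<longrightarrow>
        A ** X - X ** A = 0 \<longrightarrow> X = 0)"

definition eigenspace :: "real^'v::finite^'v \<Rightarrow> real \<Rightarrow> (real^'v) set" where
  "eigenspace A c = {x. A *v x = c *\<^sub>R x}"

text \<open>
  The distinct eigenvalues paired with their multiplicities.  Only symmetric matrices occur here:
  their eigenvalues are all real, and algebraic and geometric multiplicity agree.
\<close>

definition spec :: "real^'v::finite^'v \<Rightarrow> (real \<times> nat) set" where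
  "spec A = {(c, dim (eigenspace A c)) | c. \<exists>x. x \<noteq> 0 \<and> A *v x = c *\<^sub>R x}"

text \<open>
  The path visiting the given (distinct) vertices in this order; its endpoints are the first and
  the last element of the list.
\<close>

definition path_graph :: "'a list \<Rightarrow> 'a pair_pre_digraph" where
  "path_graph xs =
     \<lparr> pverts = set xs,
       parcs = {(xs ! i, xs ! j) | i j. i < length xs \<and> j < length xs \<and> (j = Suc i \<or> i = Suc j)} \<rparr>"

definition disjoint_union_graph ::
    "'a pair_pre_digraph \<Rightarrow> 'b pair_pre_digraph \<Rightarrow> ('a + 'b) pair_pre_digraph" where
  "disjoint_union_graph G H =
     \<lparr> pverts = pverts G <+> pverts H,
       parcs = map_prod Inl Inl ` parcs G \<union> map_prod Inr Inr ` parcs H \<rparr>"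

text \<open>The disjoint union of \<open>G\<close> and \<open>H\<close> with the vertex \<open>e\<close> of \<open>G\<close> joined to all vertices of \<open>H\<close>.\<close>

definition join_at ::
    "'a pair_pre_digraph \<Rightarrow> 'a \<Rightarrow> 'b pair_pre_digraph \<Rightarrow> ('a + 'b) pair_pre_digraph" where
  "join_at G e H =
     \<lparr> pverts = pverts (disjoint_union_graph G H),
       parcs = parcs (disjoint_union_graph G H)
         \<union> {(Inl e, Inr v) | v. v \<in> pverts H} \<union> {(Inr v, Inl e) | v. v \<in> pverts H} \<rparr>"

end

theory Submission
  imports Defs
begin

text \<open>
Let \<open>v\<close> be a positive eigenvector of a matrix \<open>B'\<close> of \<open>H\<close> for its least eigenvalue \<open>\<theta>\<close>, and join a
weighted path to \<open>H\<close> along a negative multiple of \<open>v\<close>.  The resulting matrix acts as \<open>B'\<close> on the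
vectors of \<open>H\<close> orthogonal to \<open>v\<close>, and as a Jacobi (irreducible tridiagonal) matrix of order
\<open>p + 1\<close> on the span of the path and \<open>v\<close>; the corner entry of the Jacobi matrix at \<open>v\<close> is \<open>\<theta>\<close>.  So
its spectrum is that of \<open>B'\<close> without \<open>\<theta>\<close>, together with that of the Jacobi matrix.  The Jacobi
matrix is to have the eigenvalues \<open>lam 1, \<dots>, lam q\<close> and the \<open>mu j\<close>, for which arbitrary distinct
numbers above all \<open>lam i\<close> will do.

Its diagonal entry \<open>\<theta>\<close> then exceeds its least eigenvalue \<open>lam 1\<close>, so \<open>B\<close> itself cannot be used as
\<open>B'\<close>: the eigenvalue \<open>lam 1\<close> of \<open>B\<close> has to be raised a little to \<open>\<theta>\<close>, with all other eigenvalues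
and the graph unchanged.  This is where the SSP of \<open>B\<close> enters.  It says that the orbit of \<open>B\<close>
under orthogonal conjugation and the space of matrices with the pattern of \<open>H\<close> meet transversally
at \<open>B\<close>.  By an open mapping argument every symmetric matrix near \<open>B\<close>, in particular \<open>B\<close> plus a
small multiple of the eigenprojection for \<open>lam 1\<close>, is orthogonally similar to a matrix of \<open>H\<close> with
the SSP (\<open>SSP_perturbation\<close>).

How far \<open>\<theta>\<close> may move is prescribed by \<open>B\<close>, so a Jacobi matrix with the given spectrum is needed
whose corner entry is as close to \<open>lam 1\<close> as desired.  It comes from the three-term recurrence of
the polynomials orthogonal with respect to point masses at the prescribed eigenvalues: the corner
entry is the mean of the distribution, which tends to \<open>lam 1\<close> when the mass concentrates there
(\<open>jacobi_coefficients_exist\<close>).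

Finally the SSP of \<open>B'\<close> passes to the enlarged matrix for all nonzero weights
(\<open>SSP_joined_matrix\<close>): a matrix \<open>X\<close> as in the definition of the SSP vanishes on \<open>H\<close> by the SSP of
\<open>B'\<close>, and then its diagonals vanish one after the other, counted by the distance of two vertices
along the path.
\<close>

section \<open>Jacobi coefficients with prescribed spectrum\<close>

text \<open>
The real line with finitely many positive point masses.  Its bilinear form is positive definite on
polynomials of degree less than the number of nodes, which is as far as orthogonalisation can go.
\<close>

locale weighted_nodes =
  fixes N :: "real set" and w :: "real \<Rightarrow> real"
  assumes finite_nodes: "finite N" and weight_pos: "x \<in> N \<Longrightarrow> 0 < w x"
begin

definition ip :: "real poly \<Rightarrow> real poly \<Rightarrow> real" where
  "ip f g = (\<Sum>x\<in>N. w x * poly f x * poly g x)"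

text \<open>
The Stieltjes procedure: the monic orthogonal polynomials of the form \<open>ip\<close>, defined directly by
their three-term recurrence.  It is meaningful up to index \<open>card N\<close>: the polynomial with this
index has norm zero, and the next step divides by that norm.
\<close>

fun monic_orth :: "nat \<Rightarrow> real poly" where
  "monic_orth 0 = 1"
| "monic_orth (Suc 0) = [:- (ip [:0, 1:] 1 / ip 1 1), 1:]"
| "monic_orth (Suc (Suc k)) =
     (let f = monic_orth (Suc k); g = monic_orth k
      in [:- (ip ([:0, 1:] * f) f / ip f f), 1:] * f - smult (ip f f / ip g g) g)"

definition diag_coeff :: "nat \<Rightarrow> real" where
  "diag_coeff k = ip ([:0, 1:] * monic_orth k) (monic_orth k) / ip (monic_orth k) (monic_orth k)"

definition offdiag_coeff :: "nat \<Rightarrow> real" where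
  "offdiag_coeff k =
     ip (monic_orth k) (monic_orth k) / ip (monic_orth (k - 1)) (monic_orth (k - 1))"

lemma ip_commute: "ip f g = ip g f"
  by (simp add: ip_def mult_ac)

lemma ip_diff_left: "ip (f - g) h = ip f h - ip g h"
  by (simp add: ip_def algebra_simps sum_subtractf)

lemma ip_add_left: "ip (f + g) h = ip f h + ip g h"
  by (simp add: ip_def algebra_simps sum.distrib)

lemma ip_smult_left: "ip (smult c f) h = c * ip f h"
  by (simp add: ip_def algebra_simps sum_distrib_left)

lemma ip_mult_shift: "ip (h * f) g = ip f (h * g)"
  by (simp add: ip_def mult_ac)

lemma ip_zero_left [simp]: "ip 0 h = 0"
  by (simp add: ip_def)

lemma ip_self_nonneg: "0 \<le> ip f f"
  unfolding ip_def using weight_pos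
  by (intro sum_nonneg) (metis less_imp_le mult.assoc mult_nonneg_nonneg zero_le_square)

lemma ip_self_eq_0D:
  assumes "ip f f = 0" "x \<in> N"
  shows "poly f x = 0"
proof -
  have "w x * poly f x * poly f x = 0"
  proof (rule sum_nonneg_0[where f = "\<lambda>x. w x * poly f x * poly f x", OF finite_nodes])
    show "0 \<le> w y * poly f y * poly f y" if "y \<in> N" for y
      using weight_pos[OF that] by (simp add: mult.assoc)
  qed (use assms in \<open>auto simp: ip_def\<close>)
  then show ?thesis
    using assms(2) weight_pos by fastforce
qed

lemma ip_self_pos:
  assumes "f \<noteq> 0" "degree f < card N"
  shows "0 < ip f f"
proof (rule ccontr)
  assume "\<not> 0 < ip f f"
  then have "ip f f = 0"
    using ip_self_nonneg[of f] by linarith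
  then have "N \<subseteq> {x. poly f x = 0}"
    using ip_self_eq_0D by blast
  then have "card N \<le> card {x. poly f x = 0}"
    using assms(1) by (intro card_mono poly_roots_finite)
  also have "\<dots> \<le> degree f"
    using assms(1) by (rule card_poly_roots_bound)
  finally show False
    using assms(2) by simp
qed

lemma monic_orth_step:
  "monic_orth (Suc k) =
     [:- diag_coeff k, 1:] * monic_orth k
       - (if k = 0 then 0 else smult (offdiag_coeff k) (monic_orth (k - 1)))"
  by (cases k) (simp_all add: diag_coeff_def offdiag_coeff_def Let_def)

lemma monic_orth_monic: "degree (monic_orth k) = k \<and> coeff (monic_orth k) k = 1"
proof (induction k rule: less_induct)
  case (less n)
  show ?case
  proof (cases n)
    case 0
    then show ?thesis by simp
  next
    case (Suc k)
    let ?s = "if k = 0 then 0 else smult (offdiag_coeff k) (monic_orth (k - 1))"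
    have ds: "degree ?s < Suc k"
      using less.IH[of "k - 1"] Suc by auto
    have k: "degree (monic_orth k) = k" "coeff (monic_orth k) k = 1"
      using less.IH[of k] Suc by auto
    have nz: "monic_orth k \<noteq> 0"
      using k(2) by auto
    have d: "degree ([:- diag_coeff k, 1:] * monic_orth k) = Suc k"
      using nz k(1) by (subst degree_mult_eq) auto
    have c: "coeff ([:- diag_coeff k, 1:] * monic_orth k) (Suc k) = 1"
      using k by (simp add: coeff_eq_0)
    have "coeff (monic_orth (Suc k)) (Suc k) = 1"
      unfolding monic_orth_step[of k] coeff_diff c using ds by (simp only: coeff_eq_0)
    moreover have "degree (monic_orth (Suc k)) \<le> Suc k"
      unfolding monic_orth_step[of k] using d ds by (intro degree_diff_le) linarith+
    ultimately show ?thesis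
      using Suc by (metis le_antisym le_degree zero_neq_one)
  qed
qed

lemma monic_orth_nonzero: "monic_orth k \<noteq> 0"
  using monic_orth_monic[of k] by auto

lemma monic_orth_norm_pos: "k < card N \<Longrightarrow> 0 < ip (monic_orth k) (monic_orth k)"
  using ip_self_pos monic_orth_monic monic_orth_nonzero by metis

lemma offdiag_coeff_pos: "k < card N \<Longrightarrow> 0 < offdiag_coeff k"
  by (simp add: offdiag_coeff_def monic_orth_norm_pos)

lemma monic_orth_times_x:
  "[:0, 1:] * monic_orth k =
     monic_orth (Suc k) + smult (diag_coeff k) (monic_orth k)
       + (if k = 0 then 0 else smult (offdiag_coeff k) (monic_orth (k - 1)))"
  unfolding monic_orth_step[of k] by (simp add: algebra_simps)

text \<open>
Multiplication by the variable is self-adjoint for \<open>ip\<close>.  So in the inner product of the next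
polynomial with an earlier one, the factor \<open>[:0, 1:]\<close> can be moved to the earlier one, where the
recurrence turns it into polynomials whose inner products are known.
\<close>

lemma monic_orth_orthogonal:
  assumes "k \<le> card N" "j < k"
  shows "ip (monic_orth k) (monic_orth j) = 0"
  using assms
proof (induction k arbitrary: j rule: less_induct)
  case (less n)
  obtain k where n: "n = Suc k"
    using less.prems(2) by (cases n) auto
  let ?P = monic_orth
  have IH: "ip (?P a) (?P b) = 0" if "a \<noteq> b" "a \<le> k" "b \<le> k" for a b
  proof (cases "b < a")
    case True
    then show ?thesis using less.IH[of a b] that less.prems n by simp
  next
    case False
    then show ?thesis using less.IH[of b a] that less.prems n by (simp add: ip_commute[of "?P a"])
  qed
  have nk: "ip (?P i) (?P i) > 0" if "i \<le> k" for i
    using monic_orth_norm_pos[of i] that less.prems n by simp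
  let ?t = "ip (if k = 0 then 0 else smult (offdiag_coeff k) (?P (k - 1))) (?P j)"
  have expand: "ip (?P n) (?P j) = ip (?P k) ([:0, 1:] * ?P j) - diag_coeff k * ip (?P k) (?P j) - ?t"
  proof -
    have "?P n = [:0, 1:] * ?P k - smult (diag_coeff k) (?P k)
        - (if k = 0 then 0 else smult (offdiag_coeff k) (?P (k - 1)))"
      unfolding n monic_orth_step[of k] by (simp add: algebra_simps)
    then show ?thesis
      by (simp only: ip_diff_left ip_smult_left ip_mult_shift)
  qed
  show ?case
  proof (cases "j = k")
    case True
    have "?t = 0"
      using True IH[of "k - 1" k] by (simp add: ip_smult_left)
    moreover have "ip (?P k) ([:0, 1:] * ?P k) = diag_coeff k * ip (?P k) (?P k)"
      using nk[of k] unfolding diag_coeff_def ip_commute[of "?P k" "[:0, 1:] * ?P k"] by simp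
    ultimately show ?thesis
      using expand True by simp
  next
    case False
    then have jk: "j < k"
      using less.prems n by simp
    have "ip (?P k) ([:0, 1:] * ?P j) = ip (?P (Suc j)) (?P k)"
      unfolding ip_commute[of "?P k"] monic_orth_times_x[of j] ip_add_left ip_smult_left
      using IH[of j k] IH[of "j - 1" k] jk by (simp add: ip_smult_left)
    moreover have "?t = ip (?P (Suc j)) (?P k)"
    proof (cases "Suc j = k")
      case True
      then have "?t = offdiag_coeff k * ip (?P j) (?P j)"
        using ip_smult_left by auto
      also have "\<dots> = ip (?P k) (?P k)"
        unfolding offdiag_coeff_def using nk[of j] True by auto
      finally show ?thesis
        using True by simp
    next
      case False
      then show ?thesis
        using IH[of "k - 1" j] IH[of "Suc j" k] jk by (simp add: ip_smult_left)
    qed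
    ultimately show ?thesis
      using expand IH[of k j] jk by simp
  qed
qed

lemma monic_orth_orthogonal_degree:
  assumes "degree g < card N"
  shows "ip (monic_orth (card N)) g = 0"
  using assms
proof (induction "degree g" arbitrary: g rule: less_induct)
  case less
  let ?d = "degree g" and ?P = monic_orth
  let ?r = "g - smult (lead_coeff g) (?P ?d)"
  have "ip (?P (card N)) ?r = 0"
  proof (cases "?r = 0")
    case True
    then show ?thesis by (simp add: ip_commute[of _ 0] del: right_minus_eq)
  next
    case False
    have "degree ?r \<le> ?d"
      using monic_orth_monic[of ?d] by (intro degree_diff_le) auto
    moreover have "coeff ?r ?d = 0"
      using monic_orth_monic[of ?d] by simp
    ultimately have "degree ?r < ?d"
      using False by (metis le_neq_implies_less leading_coeff_0_iff)
    then show ?thesis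
      using less by simp
  qed
  then show ?case
    using monic_orth_orthogonal[of "card N" ?d] less.prems
    by (simp add: ip_commute[of "?P (card N)"] ip_diff_left ip_smult_left)
qed

text \<open>
After \<open>card N\<close> steps the procedure ends with the polynomial that vanishes at all nodes: both this
polynomial and \<open>monic_orth (card N)\<close> are monic of degree \<open>card N\<close>, so their difference has smaller
degree and is orthogonal to \<open>monic_orth (card N)\<close>, which makes the latter orthogonal to itself.
\<close>

lemma monic_orth_last_roots: "poly (monic_orth (card N)) c = 0 \<longleftrightarrow> c \<in> N"
proof -
  let ?P = "monic_orth (card N)" and ?Q = "\<Prod>x\<in>N. [:- x, 1:]"
  have dQ: "degree ?Q = card N"
    using finite_nodes by (subst degree_prod_eq_sum_degree) auto
  have lQ: "lead_coeff ?Q = 1"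
    by (simp add: lead_coeff_prod)
  have van: "poly ?Q x = 0" if "x \<in> N" for x
    using that finite_nodes by (auto simp: poly_prod)
  have nodes: "poly ?P x = 0" if "x \<in> N" for x
  proof (cases "?P - ?Q = 0")
    case True
    then show ?thesis using van[OF that] by simp
  next
    case False
    have "degree (?P - ?Q) \<le> card N"
      using monic_orth_monic[of "card N"] dQ by (intro degree_diff_le) auto
    moreover have "coeff (?P - ?Q) (card N) = 0"
      using monic_orth_monic[of "card N"] dQ lQ by simp
    ultimately have "degree (?P - ?Q) < card N"
      using False by (metis le_neq_implies_less leading_coeff_0_iff)
    then have "ip ?P (?P - ?Q) = 0"
      by (rule monic_orth_orthogonal_degree)
    moreover have "ip ?P (?P - ?Q) = ip ?P ?P"
      unfolding ip_def using van by (intro sum.cong) auto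
    ultimately show ?thesis
      using ip_self_eq_0D that by simp
  qed
  have "c \<in> N" if "poly ?P c = 0"
  proof (rule ccontr)
    assume "c \<notin> N"
    then have "Suc (card N) = card (insert c N)"
      using finite_nodes by simp
    also have "\<dots> \<le> card {x. poly ?P x = 0}"
      using nodes that monic_orth_nonzero by (intro card_mono poly_roots_finite) auto
    also have "\<dots> \<le> card N"
      using card_poly_roots_bound[OF monic_orth_nonzero, of "card N"] monic_orth_monic by simp
    finally show False by simp
  qed
  then show ?thesis
    using nodes by blast
qed

end

text \<open>
The numbers \<open>\<alpha> 0, \<dots>, \<alpha> p\<close> and \<open>\<beta> 1, \<dots>, \<beta> p\<close> are the diagonal and off-diagonal entries of a Jacobi
matrix, and \<open>P k\<close> is the characteristic polynomial of its leading block of order \<open>k\<close>.  The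
spectrum \<open>N\<close> is prescribed, and the corner entry \<open>\<alpha> 0\<close> can be brought arbitrarily close to the
least eigenvalue, because it is the mean of the point masses.
\<close>

lemma jacobi_coefficients_exist:
  fixes N :: "real set" and lam eps :: real
  assumes N: "finite N" "card N = Suc p" "1 \<le> p"
    and lam: "lam \<in> N" "\<forall>x\<in>N. lam \<le> x" and eps: "0 < eps"
  obtains \<alpha> \<beta> :: "nat \<Rightarrow> real" and P :: "nat \<Rightarrow> real \<Rightarrow> real"
  where "lam < \<alpha> 0" "\<alpha> 0 < lam + eps" "\<And>k. k \<le> p \<Longrightarrow> 0 < \<beta> k" "\<And>c. P 0 c = 1"
    "\<And>k c. P (Suc k) c = (c - \<alpha> k) * P k c - (if k = 0 then 0 else (\<beta> k)\<^sup>2 * P (k - 1) c)"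
    "\<And>c. P (Suc p) c = 0 \<longleftrightarrow> c \<in> N"
proof -
  define S where "S = (\<Sum>x\<in>N. x - lam)"
  have "\<exists>y\<in>N. y \<noteq> lam"
  proof (rule ccontr)
    assume "\<not> ?thesis"
    then have "N \<subseteq> {lam}" by blast
    then have "card N \<le> 1"
      by (metis card_mono finite.emptyI finite_insert is_singletonI is_singleton_altdef)
    then show False using N by simp
  qed
  then obtain y where y: "y \<in> N" "y \<noteq> lam" by blast
  have S: "0 < S"
    unfolding S_def using N(1) y lam by (intro sum_pos2[of _ y]) force+
  \<comment> \<open>Mass 1 at \<open>lam\<close> and mass \<open>\<delta>\<close> elsewhere move the mean away from \<open>lam\<close> by at most \<open>\<delta> * S\<close>.\<close>
  define \<delta> where "\<delta> = eps / (S + 1)"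
  have \<delta>: "0 < \<delta>" "\<delta> * S < eps"
    using S eps by (auto simp: \<delta>_def field_simps)
  define w where "w x = (if x = lam then 1 else \<delta>)" for x
  interpret weighted_nodes N w
    using N(1) \<delta>(1) by unfold_locales (auto simp: w_def)
  define W where "W = (\<Sum>x\<in>N. w x)"
  have "w lam \<le> W"
    unfolding W_def using N(1) lam \<delta>(1) by (intro member_le_sum) (auto simp: w_def)
  then have W: "1 \<le> W"
    by (simp add: w_def)
  have num: "(\<Sum>x\<in>N. w x * (x - lam)) = \<delta> * S"
    unfolding S_def sum_distrib_left by (intro sum.cong) (auto simp: w_def)
  have "ip [:0, 1:] 1 = lam * W + (\<Sum>x\<in>N. w x * (x - lam))"
    unfolding ip_def W_def sum_distrib_left sum.distrib[symmetric]
    by (intro sum.cong) (auto simp: algebra_simps)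
  then have "ip [:0, 1:] 1 = lam * W + \<delta> * S"
    using num by simp
  moreover have "ip 1 1 = W"
    by (simp add: ip_def W_def)
  ultimately have d0: "diag_coeff 0 = lam + \<delta> * S / W"
    using W unfolding diag_coeff_def by (simp add: field_simps)
  have q: "0 < \<delta> * S / W" "\<delta> * S / W \<le> \<delta> * S"
    using \<delta> S W by (auto simp: field_simps mult_le_cancel_left1)
  define \<beta> where "\<beta> k = sqrt (offdiag_coeff k)" for k
  have sq: "(\<beta> k)\<^sup>2 = offdiag_coeff k" for k
    unfolding \<beta>_def offdiag_coeff_def by (simp add: ip_self_nonneg)
  show ?thesis
  proof (rule that[of diag_coeff \<beta> "\<lambda>k. poly (monic_orth k)"])
    show "lam < diag_coeff 0" "diag_coeff 0 < lam + eps"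
      using d0 q \<delta>(2) by linarith+
    show "0 < \<beta> k" if "k \<le> p" for k
      using that offdiag_coeff_pos[of k] N(2) by (simp add: \<beta>_def)
    show "poly (monic_orth (Suc k)) c = (c - diag_coeff k) * poly (monic_orth k) c
        - (if k = 0 then 0 else (\<beta> k)\<^sup>2 * poly (monic_orth (k - 1)) c)" for k c
      unfolding monic_orth_step[of k] sq by (simp add: algebra_simps)
    show "(poly (monic_orth (Suc p)) c = 0) = (c \<in> N)" for c
      using monic_orth_last_roots[of c] N(2) by simp
  qed simp
qed

section \<open>Perturbing a matrix with the strong spectral property\<close>

lemma inner_matrix_eq_sum:
  fixes X Y :: "real^'n^'m"
  shows "X \<bullet> Y = (\<Sum>i\<in>UNIV. \<Sum>j\<in>UNIV. X $ i $ j * Y $ i $ j)"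
  by (simp add: inner_vec_def)

lemma inner_matrix_mult_left:
  fixes A X Y :: "real^'n^'n"
  shows "X \<bullet> (A ** Y) = (transpose A ** X) \<bullet> Y"
proof -
  have "X \<bullet> (A ** Y) = (\<Sum>i\<in>UNIV. \<Sum>j\<in>UNIV. \<Sum>k\<in>UNIV. X $ i $ j * (A $ i $ k * Y $ k $ j))"
    by (simp add: inner_matrix_eq_sum matrix_matrix_mult_def sum_distrib_left)
  also have "\<dots> = (\<Sum>i\<in>UNIV. \<Sum>k\<in>UNIV. \<Sum>j\<in>UNIV. X $ i $ j * (A $ i $ k * Y $ k $ j))"
    by (intro sum.cong refl sum.swap)
  also have "\<dots> = (\<Sum>k\<in>UNIV. \<Sum>i\<in>UNIV. \<Sum>j\<in>UNIV. X $ i $ j * (A $ i $ k * Y $ k $ j))"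
    by (rule sum.swap)
  also have "\<dots> = (\<Sum>k\<in>UNIV. \<Sum>j\<in>UNIV. \<Sum>i\<in>UNIV. X $ i $ j * (A $ i $ k * Y $ k $ j))"
    by (intro sum.cong refl sum.swap)
  also have "\<dots> = (transpose A ** X) \<bullet> Y"
    by (simp add: inner_matrix_eq_sum matrix_matrix_mult_def sum_distrib_left transpose_def mult_ac)
  finally show ?thesis .
qed

lemma inner_transpose_transpose:
  fixes X Y :: "real^'n^'m"
  shows "transpose X \<bullet> transpose Y = X \<bullet> Y"
  unfolding inner_matrix_eq_sum transpose_def by (subst sum.swap) simp

lemma inner_matrix_mult_right:
  fixes A X Y :: "real^'n^'n"
  shows "X \<bullet> (Y ** A) = (X ** transpose A) \<bullet> Y"
  using inner_matrix_mult_left[of "transpose X" "transpose A" "transpose Y"]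
  by (metis inner_transpose_transpose matrix_transpose_mul transpose_transpose)

lemma bounded_bilinear_matrix_mult:
  "bounded_bilinear ((**) :: real^'n^'n \<Rightarrow> real^'n^'n \<Rightarrow> real^'n^'n)"
  unfolding bilinear_conv_bounded_bilinear[symmetric] bilinear_def
  by (auto intro!: linearI simp: vec_eq_iff matrix_matrix_mult_def algebra_simps sum.distrib
        sum_distrib_left)

lemma linear_transpose: "linear (transpose :: real^'n^'n \<Rightarrow> real^'n^'n)"
  by (auto intro!: linearI simp: vec_eq_iff transpose_def)

lemma symmetric_nth:
  fixes A :: "'a^'n^'n"
  assumes "transpose A = A"
  shows "A $ i $ j = A $ j $ i"
proof -
  have "transpose A $ j $ i = A $ i $ j"
    by (simp add: transpose_def)
  then show ?thesis
    using assms by simp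
qed

lemma transpose_add: "transpose (A + B) = transpose A + transpose (B :: real^'n^'m)"
  by (simp add: vec_eq_iff transpose_def)

lemma transpose_diff: "transpose (A - B) = transpose A - transpose (B :: real^'n^'m)"
  by (simp add: vec_eq_iff transpose_def)

lemma transpose_scaleR: "transpose (c *\<^sub>R A) = c *\<^sub>R transpose (A :: real^'n^'m)"
  by (simp add: vec_eq_iff transpose_def)

lemma symmetric_eq_skew_imp_zero:
  fixes A :: "real^'n^'n"
  assumes "transpose A = A" "A = S - transpose S"
  shows "A = 0"
proof -
  have "transpose A = - A"
    unfolding assms(2) by (simp add: transpose_diff)
  then have "A + A = 0"
    using assms(1) by (metis add.right_inverse)
  then show ?thesis
    by (simp add: vec_eq_iff)
qed

text \<open>
For symmetric arcs, this is the orthogonal complement, within the symmetric matrices, of those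
with the pattern of \<open>G\<close>: the normal space that the SSP tests.
\<close>

definition nonedge_space :: "'v::finite pair_pre_digraph \<Rightarrow> (real^'v^'v) set" where
  "nonedge_space G =
     {X. transpose X = X \<and> (\<forall>i. X $ i $ i = 0) \<and> (\<forall>i j. (i, j) \<in> parcs G \<longrightarrow> X $ i $ j = 0)}"

text \<open>
Symmetrisation followed by restriction to the diagonal and the edges.  When the arcs are
symmetric, this is the orthogonal projection of a matrix onto the symmetric matrices with the
pattern of \<open>G\<close>.
\<close>

definition edge_part :: "'v::finite pair_pre_digraph \<Rightarrow> real^'v^'v \<Rightarrow> real^'v^'v" where
  "edge_part G N =
     (\<chi> i j. if i = j \<or> (i, j) \<in> parcs G then (N $ i $ j + N $ j $ i) / 2 else 0)"

lemma linear_edge_part: "linear (edge_part G)"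
  by (auto intro!: linearI simp: vec_eq_iff edge_part_def algebra_simps add_divide_distrib)

lemma discrete_schrodinger_transpose: "A \<in> discrete_schrodinger G \<Longrightarrow> transpose A = A"
  by (simp add: discrete_schrodinger_def)

lemma discrete_schrodinger_arc_sym:
  assumes "A \<in> discrete_schrodinger G" "(i, j) \<in> parcs G"
  shows "(j, i) \<in> parcs G"
proof (cases "i = j")
  case False
  have "A $ j $ i = A $ i $ j"
    by (rule symmetric_nth[OF discrete_schrodinger_transpose[OF assms(1)]])
  moreover have "if (a, b) \<in> parcs G then A $ a $ b < 0 else A $ a $ b = 0" if "a \<noteq> b" for a b
    using assms(1) that by (simp add: discrete_schrodinger_def)
  ultimately show ?thesis
    using assms(2) False by (metis less_irrefl)
qed (use assms in simp)

text \<open>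
The test matrices \<open>X\<close> in the definition of the SSP depend on \<open>A\<close> only through its zero pattern, so
all matrices of one graph share the same space of test matrices.
\<close>

lemma SSP_iff_nonedge_space:
  assumes A: "A \<in> discrete_schrodinger G"
  shows "SSP A \<longleftrightarrow> (\<forall>X\<in>nonedge_space G. A ** X = X ** A \<longrightarrow> X = 0)"
proof -
  have mask: "A * X = 0 \<and> mat 1 * X = 0 \<longleftrightarrow> (\<forall>i. X $ i $ i = 0) \<and> (\<forall>i j. (i, j) \<in> parcs G \<longrightarrow> X $ i $ j = 0)"
    for X :: "real^'a^'a"
  proof -
    have 1: "mat 1 * X = 0 \<longleftrightarrow> (\<forall>i. X $ i $ i = 0)"
      by (auto simp: vec_eq_iff mat_def)
    have 2: "A * X = 0 \<longleftrightarrow> (\<forall>i j. (i, j) \<in> parcs G \<longrightarrow> X $ i $ j = 0)"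
      if diag: "\<forall>i. X $ i $ i = 0"
    proof -
      have "(A $ i $ j * X $ i $ j = 0) \<longleftrightarrow> ((i, j) \<in> parcs G \<longrightarrow> X $ i $ j = 0)" for i j
      proof (cases "i = j")
        case True
        then show ?thesis using diag by simp
      next
        case False
        then have "if (i, j) \<in> parcs G then A $ i $ j < 0 else A $ i $ j = 0"
          using A by (simp add: discrete_schrodinger_def)
        then show ?thesis by (auto split: if_splits)
      qed
      then show ?thesis
        by (simp add: vec_eq_iff)
    qed
    show ?thesis
      using 1 2 by blast
  qed
  have "SSP A \<longleftrightarrow> (\<forall>X. transpose X = X \<longrightarrow> (A * X = 0 \<and> mat 1 * X = 0) \<longrightarrow> A ** X = X ** A \<longrightarrow> X = 0)"
    using discrete_schrodinger_transpose[OF A] by (simp add: SSP_def imp_conjL)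
  then show ?thesis
    unfolding mask nonedge_space_def by blast
qed

text \<open>
The commutator with \<open>B\<close> is injective on the finite-dimensional \<open>nonedge_space\<close>, hence bounded
below there by a positive multiple of the norm, and a small change of \<open>B\<close> cannot destroy such a
bound.
\<close>

lemma SSP_open:
  assumes B: "B \<in> discrete_schrodinger G" "SSP B"
  shows "\<exists>e>0. \<forall>A\<in>discrete_schrodinger G. dist A B < e \<longrightarrow> SSP A"
proof -
  interpret mm: bounded_bilinear "(**) :: real^'a^'a \<Rightarrow> real^'a^'a \<Rightarrow> real^'a^'a"
    by (rule bounded_bilinear_matrix_mult)
  have "transpose (0 :: real^'a^'a) = 0"
    by (simp add: transpose_def vec_eq_iff)
  then have sub: "subspace (nonedge_space G)"
    by (simp add: subspace_def nonedge_space_def transpose_add transpose_scaleR)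
  have "bounded_linear (\<lambda>X. B ** X - X ** B)"
    by (rule bounded_linear_sub[OF mm.bounded_linear_right mm.bounded_linear_left])
  moreover have "\<forall>X\<in>nonedge_space G. B ** X - X ** B = 0 \<longrightarrow> X = 0"
    using B(2) unfolding SSP_iff_nonedge_space[OF B(1)] by simp
  ultimately have "\<exists>c>0. \<forall>X\<in>nonedge_space G. c * norm X \<le> norm (B ** X - X ** B)"
    by (rule injective_imp_isometric[OF closed_subspace[OF sub] sub])
  then obtain c where c: "c > 0" "\<And>X. X \<in> nonedge_space G \<Longrightarrow> c * norm X \<le> norm (B ** X - X ** B)"
    by blast
  obtain K where "0 < K" and "\<forall>(X :: real^'a^'a) (Y :: real^'a^'a). norm (X ** Y) \<le> norm X * norm Y * K"
    using mm.pos_bounded by blast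
  then have K: "K > 0" "norm (X ** Y) \<le> norm X * norm Y * K" for X :: "real^'a^'a" and Y :: "real^'a^'a"
    by simp_all
  show ?thesis
  proof (intro exI conjI ballI impI)
    show "c / (2 * K) > 0" using c K by simp
    fix A assume A: "A \<in> discrete_schrodinger G" and d: "dist A B < c / (2 * K)"
    have "X = 0" if X: "X \<in> nonedge_space G" "A ** X = X ** A" for X
    proof (rule ccontr)
      assume "X \<noteq> 0"
      have "B ** X - X ** B = (B - A) ** X - X ** (B - A)"
        using X(2) by (simp add: mm.diff_left mm.diff_right)
      then have "c * norm X \<le> norm ((B - A) ** X - X ** (B - A))"
        using c(2)[OF X(1)] by simp
      also have "\<dots> \<le> norm ((B - A) ** X) + norm (X ** (B - A))"
        by (rule norm_triangle_ineq4)
      also have "\<dots> \<le> norm (B - A) * norm X * K + norm X * norm (B - A) * K"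
        by (intro add_mono K)
      also have "\<dots> = (2 * K * dist A B) * norm X"
        unfolding dist_norm norm_minus_commute[of A B] by (simp add: algebra_simps)
      also have "\<dots> < c * norm X"
      proof (rule mult_strict_right_mono)
        show "2 * K * dist A B < c"
          using d K(1) by (simp add: pos_less_divide_eq mult.commute)
      qed (use \<open>X \<noteq> 0\<close> in simp)
      finally show False by simp
    qed
    then show "SSP A"
      using SSP_iff_nonedge_space[OF A] by blast
  qed
qed

text \<open>
The commutators \<open>B ** K - K ** B\<close> with skew \<open>K\<close> are the tangent directions of the orthogonal orbit
of \<open>B\<close>.  With the symmetric matrices of the pattern of \<open>G\<close> and all skew matrices they span the
whole matrix space: a matrix orthogonal to all of these is symmetric, vanishes on the pattern and
commutes with \<open>B\<close>, so it is zero by the SSP.  The skew summand makes the map surjective onto all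
matrices, as an open mapping theorem between full matrix spaces requires.
\<close>

lemma SSP_transversal:
  assumes B: "B \<in> discrete_schrodinger G" "SSP B"
  shows "\<exists>L N. B ** (L - transpose L) - (L - transpose L) ** B
               - (edge_part G N + (N - transpose N)) = Y"
proof -
  interpret mm: bounded_bilinear "(**) :: real^'a^'a \<Rightarrow> real^'a^'a \<Rightarrow> real^'a^'a"
    by (rule bounded_bilinear_matrix_mult)
  interpret tr: linear "transpose :: real^'a^'a \<Rightarrow> real^'a^'a"
    by (rule linear_transpose)
  interpret ep: linear "edge_part G"
    by (rule linear_edge_part)
  define F where "F = (\<lambda>(L, N). B ** (L - transpose L) - (L - transpose L) ** B
      - (edge_part G N + (N - transpose N)))"
  have lin: "linear F"
    by (auto intro!: linearI simp: F_def tr.add tr.scaleR ep.add ep.scaleR mm.add_left mm.add_right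
          mm.diff_left mm.diff_right mm.scaleR_left mm.scaleR_right algebra_simps)
  have symB: "transpose B = B"
    by (rule discrete_schrodinger_transpose[OF B(1)])
  have "span (range F) = UNIV"
  proof (rule ccontr)
    assume "span (range F) \<noteq> UNIV"
    then obtain X where X: "X \<noteq> 0" "\<And>L N. X \<bullet> F (L, N) = 0"
      using span_not_UNIV_orthogonal span_base by (metis rangeI)
    have N0: "X \<bullet> (edge_part G N + (N - transpose N)) = 0" for N
      using X(2)[of 0 N]
      by (simp add: F_def mm.zero_right mm.zero_left tr.zero inner_diff_right inner_add_right)
    have L0: "X \<bullet> (B ** (L - transpose L) - (L - transpose L) ** B) = 0" for L
      using X(2)[of L 0] by (simp add: F_def ep.zero tr.zero)
    have symX: "transpose X = X"
    proof -
      let ?S = "X - transpose X"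
      have "edge_part G ?S = 0"
        by (auto simp: edge_part_def vec_eq_iff transpose_def)
      then have "X \<bullet> (2 *\<^sub>R ?S) = 0"
        using N0[of ?S] by (simp add: tr.diff scaleR_2 algebra_simps)
      then have "X \<bullet> ?S = 0"
        by simp
      moreover have "transpose X \<bullet> ?S = - (X \<bullet> ?S)"
        using inner_transpose_transpose[of X ?S] by (simp add: tr.diff inner_diff_right)
      ultimately have "?S \<bullet> ?S = 0"
        by (simp add: inner_diff_left)
      then show ?thesis by simp
    qed
    have mask: "X $ i $ j = 0" if ij: "i = j \<or> (i, j) \<in> parcs G" for i j
    proof -
      let ?P = "\<chi> i j. if i = j \<or> (i, j) \<in> parcs G then X $ i $ j else 0"
      have sx: "X $ a $ b = X $ b $ a" for a b
        by (rule symmetric_nth[OF symX])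
      have sP: "transpose ?P = ?P"
        using sx discrete_schrodinger_arc_sym[OF B(1)] by (auto simp: vec_eq_iff transpose_def)
      have "edge_part G ?P = ?P"
        using sx discrete_schrodinger_arc_sym[OF B(1)] by (auto simp: vec_eq_iff edge_part_def)
      then have "X \<bullet> ?P = 0"
        using N0[of ?P] sP by simp
      moreover have "X \<bullet> ?P = ?P \<bullet> ?P"
        unfolding inner_matrix_eq_sum by (intro sum.cong) auto
      ultimately have "?P = 0"
        by simp
      then have "?P $ i $ j = 0"
        by simp
      then show ?thesis
        using ij by simp
    qed
    let ?D = "B ** X - X ** B"
    have "?D \<bullet> (L - transpose L) = 0" for L
      using L0[of L] unfolding inner_diff_right inner_diff_left
        inner_matrix_mult_left[of X B] inner_matrix_mult_right[of X _ B] symB by simp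
    moreover have "transpose ?D = - ?D"
      by (simp add: tr.diff matrix_transpose_mul symX symB)
    ultimately have "?D \<bullet> ?D + ?D \<bullet> ?D = 0"
      by (metis diff_minus_eq_add inner_add_right)
    then have "B ** X = X ** B"
      by simp
    moreover have "X \<in> nonedge_space G"
      using symX mask by (auto simp: nonedge_space_def)
    ultimately show False
      using SSP_iff_nonedge_space[OF B(1)] B(2) X(1) by blast
  qed
  moreover have "span (range F) = range F"
    by (simp add: span_eq_iff linear_subspace_image[OF lin] subspace_UNIV)
  ultimately have "Y \<in> range F"
    by simp
  then show ?thesis
    by (auto simp: F_def)
qed

lemma edges_stay_negative:
  assumes B: "B \<in> discrete_schrodinger G"
  shows "\<exists>e>0. \<forall>N. dist N B < e \<longrightarrow> (\<forall>i j. i \<noteq> j \<longrightarrow> (i, j) \<in> parcs G \<longrightarrow> N $ i $ j < 0)"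
proof -
  let ?E = "insert 1 {- (B $ i $ j) | i j. i \<noteq> j \<and> (i, j) \<in> parcs G}"
  have "{- (B $ i $ j) | i j. i \<noteq> j \<and> (i, j) \<in> parcs G} \<subseteq> (\<lambda>(i, j). - (B $ i $ j)) ` UNIV"
    by auto
  then have fin: "finite ?E"
    using finite_subset by fastforce
  have pos: "\<forall>x\<in>?E. 0 < x"
    using B by (auto simp: discrete_schrodinger_def)
  have "N $ i $ j < 0" if "dist N B < Min ?E" "i \<noteq> j" "(i, j) \<in> parcs G" for N i j
  proof -
    have "dist (N $ i $ j) (B $ i $ j) \<le> dist N B"
      by (meson dist_vec_nth_le order_trans)
    also have "\<dots> < Min ?E" by fact
    also have "\<dots> \<le> - (B $ i $ j)"
      using that fin by (intro Min_le) auto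
    finally show ?thesis
      by (simp add: dist_real_def)
  qed
  moreover have "0 < Min ?E"
    using fin pos by (subst Min_gr_iff) auto
  ultimately show ?thesis by blast
qed

lemma eigenspace_orthogonal_conjugate:
  fixes R C :: "real^'n^'n"
  assumes R: "transpose R ** R = mat 1"
  shows "dim (eigenspace (transpose R ** C ** R) c) = dim (eigenspace C c)"
proof -
  have R': "R ** transpose R = mat 1"
    using R matrix_left_right_inverse by blast
  have "eigenspace C c = (*v) R ` eigenspace (transpose R ** C ** R) c"
  proof (intro subset_antisym subsetI)
    fix x assume x: "x \<in> eigenspace C c"
    have Rx: "R *v (transpose R *v x) = x"
      by (simp add: matrix_vector_mul_assoc R' del: transpose_matrix_vector)
    have "transpose R *v x \<in> eigenspace (transpose R ** C ** R) c"
      using x by (simp add: eigenspace_def matrix_vector_mul_assoc[symmetric] Rx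
          matrix_vector_mult_scaleR del: transpose_matrix_vector)
    then show "x \<in> (*v) R ` eigenspace (transpose R ** C ** R) c"
      using Rx by (metis imageI)
  next
    fix x assume "x \<in> (*v) R ` eigenspace (transpose R ** C ** R) c"
    then obtain y where y: "x = R *v y" "transpose R ** C ** R *v y = c *\<^sub>R y"
      by (auto simp: eigenspace_def)
    have "C *v x = R *v (transpose R ** C ** R *v y)"
      unfolding y(1) by (simp add: matrix_vector_mul_assoc matrix_mul_assoc R')
    then show "x \<in> eigenspace C c"
      using y by (simp add: eigenspace_def matrix_vector_mult_scaleR)
  qed
  moreover have "inj ((*v) R)"
    using R by (metis inj_on_inverseI matrix_vector_mul_assoc matrix_vector_mul_lid)
  ultimately show ?thesis
    using dim_image_eq[of "(*v) R"] matrix_vector_mul_linear inj_on_subset by (metis subset_UNIV)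
qed

text \<open>
Put \<open>\<psi> N = edge_part G N + (N - transpose N)\<close>.  An orthogonal conjugation of \<open>C\<close> into the pattern
of \<open>G\<close> is found by solving \<open>transpose R ** C ** R = \<psi> N\<close> and
\<open>transpose R ** R + (S - transpose S) = mat 1\<close> for \<open>R\<close>, \<open>N\<close> and \<open>S\<close>.  Each of these equations has
a symmetric matrix plus a skew one equal to a symmetric matrix, so the skew parts of a solution
vanish.  At \<open>R = mat 1\<close>, \<open>N = B\<close>, \<open>S = 0\<close>, \<open>C = B\<close> the derivative is onto by \<open>SSP_transversal\<close>,
and Sussmann's open mapping theorem, which besides continuity needs differentiability at that
point only, gives a solution near it for every \<open>C\<close> near \<open>B\<close>.
\<close>

lemma SSP_perturbation:
  assumes B: "B \<in> discrete_schrodinger G" "SSP B"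
  shows "\<exists>d>0. \<forall>C. transpose C = C \<longrightarrow> dist C B < d \<longrightarrow>
           (\<exists>B'\<in>discrete_schrodinger G. SSP B' \<and> (\<forall>c. dim (eigenspace B' c) = dim (eigenspace C c)))"
proof -
  interpret mm: bounded_bilinear "(**) :: real^'a^'a \<Rightarrow> real^'a^'a \<Rightarrow> real^'a^'a"
    by (rule bounded_bilinear_matrix_mult)
  have bt: "bounded_linear (transpose :: real^'a^'a \<Rightarrow> real^'a^'a)"
    by (rule linear_conv_bounded_linear[THEN iffD1, OF linear_transpose])
  have be: "bounded_linear (edge_part G)"
    by (rule linear_conv_bounded_linear[THEN iffD1, OF linear_edge_part])
  interpret tr: bounded_linear "transpose :: real^'a^'a \<Rightarrow> real^'a^'a"
    by (rule bt)
  have symB: "transpose B = B"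
    by (rule discrete_schrodinger_transpose[OF B(1)])
  obtain e1 where e1: "e1 > 0" "\<And>A. A \<in> discrete_schrodinger G \<Longrightarrow> dist A B < e1 \<Longrightarrow> SSP A"
    using SSP_open[OF B] by blast
  obtain e2 where e2: "e2 > 0"
    "\<And>N i j. dist N B < e2 \<Longrightarrow> i \<noteq> j \<Longrightarrow> (i, j) \<in> parcs G \<Longrightarrow> N $ i $ j < 0"
    using edges_stay_negative[OF B(1)] by blast
  obtain e3 where e3: "e3 > 0" "\<And>N. dist N B < e3 \<Longrightarrow> dist (edge_part G N) (edge_part G B) < e1"
    using linear_continuous_at[OF be, of B] e1(1) unfolding continuous_at_eps_delta by blast
  have epB: "edge_part G B = B"
    using B(1) symB discrete_schrodinger_arc_sym[OF B(1)]
    by (auto simp: vec_eq_iff edge_part_def discrete_schrodinger_def transpose_def)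
  define \<psi> where "\<psi> N = edge_part G N + (N - transpose N)" for N
  have b\<psi>: "bounded_linear \<psi>"
    unfolding \<psi>_def by (intro bounded_linear_add bounded_linear_sub be bt bounded_linear_ident)
  have \<psi>B: "\<psi> B = B"
    by (simp add: \<psi>_def epB symB)
  define f :: "(real^'a^'a) \<times> (real^'a^'a) \<times> (real^'a^'a) \<times> (real^'a^'a)
      \<Rightarrow> (real^'a^'a) \<times> (real^'a^'a) \<times> (real^'a^'a)" where
    "f = (\<lambda>x. (transpose (fst x) ** snd (snd (snd x)) ** fst x - \<psi> (fst (snd x)),
          transpose (fst x) ** fst x + (fst (snd (snd x)) - transpose (fst (snd (snd x)))),
          snd (snd (snd x))))"
  define f' :: "(real^'a^'a) \<times> (real^'a^'a) \<times> (real^'a^'a) \<times> (real^'a^'a)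
      \<Rightarrow> (real^'a^'a) \<times> (real^'a^'a) \<times> (real^'a^'a)" where
    "f' = (\<lambda>h. (B ** fst h + (snd (snd (snd h)) + transpose (fst h) ** B) - \<psi> (fst (snd h)),
          fst h + transpose (fst h) + (fst (snd (snd h)) - transpose (fst (snd (snd h)))),
          snd (snd (snd h))))"
  let ?x = "(mat 1, B, 0, B) :: (real^'a^'a) \<times> (real^'a^'a) \<times> (real^'a^'a) \<times> (real^'a^'a)"
  have der: "(f has_derivative f') (at ?x)"
    unfolding f_def f'_def
    by (rule derivative_eq_intros mm.FDERIV bounded_linear.has_derivative[OF bt]
        bounded_linear.has_derivative[OF b\<psi>] refl | simp add: transpose_mat fun_eq_iff)+
  have cont: "continuous_on UNIV f"
    unfolding f_def
    by (intro continuous_intros mm.continuous_on bounded_linear.continuous_on[OF bt]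
        bounded_linear.continuous_on[OF b\<psi>])
  have lin: "linear f'"
    using der has_derivative_bounded_linear bounded_linear.linear by blast
  have surj: "surj f'"
    unfolding surj_def
  proof
    fix y :: "(real^'a^'a) \<times> (real^'a^'a) \<times> (real^'a^'a)"
    obtain Y Z C where y: "y = (Y, Z, C)" by (cases y)
    \<comment> \<open>\<open>Zs\<close> and \<open>S\<close> take care of the symmetric and the skew part of \<open>Z\<close>.  This leaves the skew part of
      the direction of \<open>R\<close> free, so that transversality can be used for the first component.\<close>
    define Zs where "Zs = (1/4) *\<^sub>R (Z + transpose Z)"
    define S where "S = (1/2) *\<^sub>R Z"
    obtain L N where LN: "B ** (L - transpose L) - (L - transpose L) ** B - \<psi> N
        = Y - C - (B ** Zs + Zs ** B)"
      unfolding \<psi>_def using SSP_transversal[OF B] by metis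
    let ?E = "Zs + (L - transpose L)"
    have tE: "transpose ?E = Zs - (L - transpose L)"
      by (simp add: Zs_def tr.add tr.diff tr.scaleR add.commute)
    have "?E + transpose ?E + (S - transpose S) = Z"
      unfolding tE by (simp add: Zs_def S_def tr.scaleR vec_eq_iff field_simps)
    moreover have "B ** ?E + (C + transpose ?E ** B) - \<psi> N = Y"
      unfolding tE using LN
      by (simp add: mm.add_right mm.add_left mm.diff_right mm.diff_left algebra_simps)
    ultimately have "y = f' (?E, N, S, C)"
      by (simp add: y f'_def)
    then show "\<exists>x. y = f' x" ..
  qed
  obtain g where g: "linear g" "f' \<circ> g = id"
    using linear_surjective_right_inverse[OF lin surj] by blast
  define T where "T = {x :: (real^'a^'a) \<times> (real^'a^'a) \<times> (real^'a^'a) \<times> (real^'a^'a).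
      dist (fst (snd x)) B < min e2 e3}"
  have "open T"
    unfolding T_def by (intro open_Collect_less continuous_intros)
  then have "?x \<in> interior T"
    using e2(1) e3(1) by (simp add: interior_open T_def)
  moreover have "bounded_linear g"
    using g(1) by (simp add: linear_conv_bounded_linear)
  ultimately have "f ?x \<in> interior (f ` T)"
    using sussmann_open_mapping[OF open_UNIV cont UNIV_I der _ g(2) subset_UNIV] by blast
  then obtain d where d: "d > 0" "ball (f ?x) d \<subseteq> f ` T"
    unfolding mem_interior by blast
  have fx: "f ?x = (0, mat 1, B)"
    by (simp add: f_def \<psi>B transpose_mat)
  have "\<exists>B'\<in>discrete_schrodinger G. SSP B' \<and> (\<forall>c. dim (eigenspace B' c) = dim (eigenspace C c))"
    if C: "transpose C = C" "dist C B < d" for C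
  proof -
    have "(0, mat 1, C) \<in> ball (f ?x) d"
      unfolding fx using C(2) by (simp add: dist_Pair_Pair dist_commute)
    then obtain R N S C' where "(R, N, S, C') \<in> T" and im: "f (R, N, S, C') = (0, mat 1, C)"
      using d(2) by (smt (verit) imageE prod_cases4 subsetD)
    then have N: "dist N B < e2" "dist N B < e3" and "C' = C"
      and eq1: "transpose R ** C ** R = edge_part G N + (N - transpose N)"
      and eq2: "transpose R ** R + (S - transpose S) = mat 1"
      by (auto simp: T_def f_def \<psi>_def)
    have symE: "transpose (edge_part G N) = edge_part G N"
      using discrete_schrodinger_arc_sym[OF B(1)]
      by (auto simp: edge_part_def vec_eq_iff transpose_def)
    have "N - transpose N = 0"
    proof (rule symmetric_eq_skew_imp_zero)
      have "transpose (transpose R ** C ** R) = transpose R ** C ** R"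
        by (simp add: matrix_transpose_mul C(1) matrix_mul_assoc)
      then show "transpose (N - transpose N) = N - transpose N"
        unfolding eq1 tr.add symE by simp
    qed simp
    then have conj: "transpose R ** C ** R = edge_part G N" and symN: "transpose N = N"
      using eq1 by simp_all
    have "S - transpose S = 0"
    proof (rule symmetric_eq_skew_imp_zero)
      have "transpose (transpose R ** R + (S - transpose S)) = transpose R ** R + (S - transpose S)"
        unfolding eq2 by (rule transpose_mat)
      then show "transpose (S - transpose S) = S - transpose S"
        by (simp add: tr.add matrix_transpose_mul)
    qed simp
    then have orth: "transpose R ** R = mat 1"
      using eq2 by simp
    have "edge_part G N \<in> discrete_schrodinger G"
      using symE e2(2)[OF N(1)] symmetric_nth[OF symN]
      by (auto simp: discrete_schrodinger_def edge_part_def)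
    moreover have "SSP (edge_part G N)"
      using e1(2)[OF calculation] e3(2)[OF N(2)] by (simp add: epB)
    ultimately show ?thesis
      using eigenspace_orthogonal_conjugate[OF orth, of C] unfolding conj by blast
  qed
  then show ?thesis
    using d(1) by blast
qed

section \<open>Least eigenvalues, eigenspaces and rank one shifts\<close>

lemma symmetric_inner_mult:
  fixes A :: "real^'n^'n"
  assumes "transpose A = A"
  shows "x \<bullet> (A *v y) = (A *v x) \<bullet> y"
  using dot_lmul_matrix[of x A y] assms by (metis transpose_matrix_vector)

text \<open>
A minimiser of the Rayleigh quotient is an eigenvector: otherwise a small step from \<open>w\<close> against
the residual \<open>r\<close> lowers \<open>y \<bullet> (A *v y) - \<mu> * (y \<bullet> y)\<close> below its minimum 0, since the first order
term of the change is negative.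
\<close>

lemma rayleigh_equality_eigenvector:
  fixes A :: "real^'n^'n"
  assumes sym: "transpose A = A" and low: "\<And>y. \<mu> * (y \<bullet> y) \<le> y \<bullet> (A *v y)"
    and eq: "w \<bullet> (A *v w) = \<mu> * (w \<bullet> w)"
  shows "A *v w = \<mu> *\<^sub>R w"
proof (rule ccontr)
  define r where "r = A *v w - \<mu> *\<^sub>R w"
  assume "A *v w \<noteq> \<mu> *\<^sub>R w"
  then have r: "0 < r \<bullet> r"
    by (simp add: r_def)
  define K where "K = r \<bullet> (A *v r) - \<mu> * (r \<bullet> r)"
  have K: "0 \<le> K"
    using low[of r] by (simp add: K_def)
  have wr: "w \<bullet> (A *v r) = r \<bullet> (A *v w)"
    using symmetric_inner_mult[OF sym, of w r] by (simp add: inner_commute)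
  have rr: "r \<bullet> (A *v w) - \<mu> * (r \<bullet> w) = r \<bullet> r"
    by (simp add: r_def inner_diff_right)
  \<comment> \<open>A step short enough for the first order term \<open>2 * (r \<bullet> r)\<close> to dominate the second order term \<open>s * K\<close>.\<close>
  define s where "s = (r \<bullet> r) / (K + 1)"
  have s: "0 < s" using r K by (simp add: s_def)
  let ?y = "w - s *\<^sub>R r"
  have "0 \<le> ?y \<bullet> (A *v ?y) - \<mu> * (?y \<bullet> ?y)"
    using low[of ?y] by simp
  also have "?y \<bullet> (A *v ?y) - \<mu> * (?y \<bullet> ?y)
      = (w \<bullet> (A *v w) - \<mu> * (w \<bullet> w)) - s * (w \<bullet> (A *v r) + r \<bullet> (A *v w) - 2 * \<mu> * (r \<bullet> w)) + s * s * K"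
    by (simp add: K_def matrix_vector_mult_diff_distrib matrix_vector_mult_scaleR inner_diff_left
        inner_diff_right inner_commute[of w r] algebra_simps)
  also have "\<dots> = s * (s * K - 2 * (r \<bullet> r))"
    using eq wr rr by (simp add: algebra_simps)
  finally have "2 * (r \<bullet> r) \<le> s * K"
    using s by (simp add: zero_le_mult_iff)
  also have "s * K \<le> r \<bullet> r"
    using K r by (simp add: s_def field_simps)
  finally show False using r by simp
qed

lemma connected_closed_set_UNIV:
  assumes conn: "Digraph_Component.connected (with_proj H)" and verts: "pverts H = UNIV"
    and sym: "\<And>i j. (i, j) \<in> parcs H \<Longrightarrow> (j, i) \<in> parcs H"
    and Z: "i \<in> Z" "\<And>i j. i \<in> Z \<Longrightarrow> (i, j) \<in> parcs H \<Longrightarrow> j \<in> Z"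
  shows "j \<in> Z"
proof -
  have "i \<rightarrow>\<^sup>*\<^bsub>with_proj (mk_symmetric (with_proj H))\<^esub> j"
    using conn verts by (auto simp: Digraph_Component.connected_def strongly_connected_def)
  then have "(i, j) \<in> rtrancl_on UNIV (parcs (mk_symmetric (with_proj H)))"
    using verts by (simp add: reachable_def)
  then show ?thesis
  proof (induction rule: rtrancl_on_induct)
    case base
    then show ?case using Z(1) by simp
  next
    case (step y z)
    then have "(y, z) \<in> parcs H"
      using sym by (auto simp: parcs_mk_symmetric)
    then show ?case using step Z(2) by blast
  qed
qed

text \<open>
The Perron-Frobenius argument.  With nonpositive off-diagonal entries, replacing the entries of a
minimiser of the Rayleigh quotient by their absolute values cannot increase the quotient, so the
result is again an eigenvector.  At a zero entry the eigenvalue equation forces the neighbouring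
entries to be zero as well, and by connectedness the whole vector would vanish.
\<close>

lemma least_eigenvalue_positive_eigenvector:
  fixes A :: "real^'v::finite^'v"
  assumes A: "A \<in> discrete_schrodinger H"
    and conn: "Digraph_Component.connected (with_proj H)" and verts: "pverts H = UNIV"
    and x: "x \<noteq> 0" "A *v x = \<theta> *\<^sub>R x"
    and least: "\<And>c y. y \<noteq> 0 \<Longrightarrow> A *v y = c *\<^sub>R y \<Longrightarrow> \<theta> \<le> c"
  obtains v where "norm v = 1" "A *v v = \<theta> *\<^sub>R v" "\<And>i. 0 < v $ i"
proof -
  note sym = discrete_schrodinger_transpose[OF A]
  let ?Q = "\<lambda>y. y \<bullet> (A *v y)"
  have "continuous_on (sphere 0 1) ?Q"
    by (intro continuous_intros matrix_vector_mult_linear_continuous_on)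
  moreover have "sphere (0 :: real^'v) 1 \<noteq> {}"
    by simp
  ultimately obtain u where u: "u \<in> sphere 0 1" "\<And>y. y \<in> sphere 0 1 \<Longrightarrow> ?Q u \<le> ?Q y"
    using continuous_attains_inf[OF compact_sphere, of "0 :: real^'v" 1 ?Q] by blast
  have u1: "u \<bullet> u = 1"
    using u(1) by (simp add: dot_square_norm)
  have low: "?Q u * (y \<bullet> y) \<le> ?Q y" for y
  proof (cases "y = 0")
    case False
    have "?Q u \<le> ?Q (y /\<^sub>R norm y)"
      using False by (intro u(2)) simp
    also have "\<dots> = ?Q y / (y \<bullet> y)"
      by (simp add: matrix_vector_mult_scaleR dot_square_norm power2_eq_square field_simps)
    finally show ?thesis
      using False by (simp add: pos_le_divide_eq)
  qed simp
  have "A *v u = ?Q u *\<^sub>R u"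
    by (rule rayleigh_equality_eigenvector[OF sym low]) (simp add: u1)
  then have "\<theta> \<le> ?Q u"
    using least[of u "?Q u"] u1 by (metis inner_zero_left zero_neq_one)
  moreover have "?Q u \<le> \<theta>"
    using low[of x] x by simp
  ultimately have Qu: "?Q u = \<theta>"
    by simp
  define y where "y = (\<chi> i. \<bar>u $ i\<bar>)"
  have off: "A $ i $ j \<le> 0" if "i \<noteq> j" for i j
  proof -
    have "if (i, j) \<in> parcs H then A $ i $ j < 0 else A $ i $ j = 0"
      using A that by (simp add: discrete_schrodinger_def)
    then show ?thesis by (auto split: if_splits)
  qed
  have y1: "y \<bullet> y = 1"
    using u1 by (simp add: y_def inner_vec_def)
  have "?Q y \<le> ?Q u"
  proof -
    have "\<bar>u $ i\<bar> * (A $ i $ j * \<bar>u $ j\<bar>) \<le> u $ i * (A $ i $ j * u $ j)" for i j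
    proof (cases "i = j")
      case True
      then show ?thesis by (simp add: mult.left_commute)
    next
      case False
      have "A $ i $ j * \<bar>u $ i * u $ j\<bar> \<le> A $ i $ j * (u $ i * u $ j)"
        using off[OF False] by (intro mult_left_mono_neg) auto
      then show ?thesis by (simp add: abs_mult mult_ac)
    qed
    then show ?thesis
      unfolding y_def inner_vec_def matrix_vector_mult_def
      by (simp add: sum_distrib_left sum_mono)
  qed
  then have "?Q y = \<theta> * (y \<bullet> y)"
    using low[of y] y1 Qu by simp
  then have eig: "A *v y = \<theta> *\<^sub>R y"
    using low Qu by (intro rayleigh_equality_eigenvector[OF sym]) auto
  have "y $ j \<noteq> 0" for j
  proof
    assume j: "y $ j = 0"
    have "y $ k = 0" if i: "y $ i = 0" "(i, k) \<in> parcs H" for i k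
    proof (cases "i = k")
      case False
      have "(\<Sum>l\<in>UNIV. - (A $ i $ l * y $ l)) = 0"
      proof -
        have "(A *v y) $ i = 0"
          using eig i by simp
        then show ?thesis
          by (simp add: matrix_vector_mult_def sum_negf)
      qed
      moreover have "0 \<le> - (A $ i $ l * y $ l)" for l
        using off[of i l] i(1) by (cases "l = i") (auto simp: y_def mult_nonpos_nonneg)
      ultimately have "- (A $ i $ k * y $ k) = 0"
        by (subst (asm) sum_nonneg_eq_0_iff) auto
      moreover have "A $ i $ k < 0"
        using A False i(2) by (auto simp: discrete_schrodinger_def)
      ultimately show ?thesis by simp
    qed (use i in simp)
    then have "k \<in> {k. y $ k = 0}" for k
      using connected_closed_set_UNIV[OF conn verts discrete_schrodinger_arc_sym[OF A],
          of j "{k. y $ k = 0}"] j by blast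
    then have "y = 0"
      by (simp add: vec_eq_iff)
    then show False
      using y1 by simp
  qed
  then have "0 < y $ i" for i
    by (metis abs_ge_zero order_le_less vec_lambda_beta y_def)
  moreover have "norm y = 1"
    using y1 by (simp add: norm_eq_sqrt_inner)
  ultimately show ?thesis
    using that eig by blast
qed

lemma subspace_eigenspace: "subspace (eigenspace A c)"
  by (auto simp: subspace_def eigenspace_def matrix_vector_right_distrib
      matrix_vector_mult_scaleR algebra_simps)

lemma dim_eigenspace_eq_0_iff: "dim (eigenspace A c) = 0 \<longleftrightarrow> (\<forall>x. A *v x = c *\<^sub>R x \<longrightarrow> x = 0)"
  by (auto simp: eigenspace_def)

lemma spec_eq: "spec A = {(c, dim (eigenspace A c)) | c. dim (eigenspace A c) \<noteq> 0}"
  unfolding spec_def dim_eigenspace_eq_0_iff by blast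

lemma simple_eigenspace:
  assumes "A *v v = l *\<^sub>R v" "v \<noteq> 0" "dim (eigenspace A l) = 1"
  shows "eigenspace A l = span {v}"
proof (rule subspace_dim_equal[symmetric])
  show "span {v} \<subseteq> eigenspace A l"
    using assms(1) by (intro span_minimal subspace_eigenspace) (simp add: eigenspace_def)
qed (use assms in \<open>simp_all add: subspace_eigenspace dim_insert\<close>)

lemma symmetric_eigenvectors_orthogonal:
  fixes A :: "real^'n::finite^'n"
  assumes "transpose A = A" "A *v x = c *\<^sub>R x" "A *v y = d *\<^sub>R y" "c \<noteq> d"
  shows "x \<bullet> y = 0"
  using symmetric_inner_mult[OF assms(1), of x y] assms(2-4) by simp

lemma dim_eigenspace_orthogonal_part:
  fixes B :: "real^'n::finite^'n"
  assumes "transpose B = B" "v \<noteq> 0" "B *v v = l *\<^sub>R v" "dim (eigenspace B l) = 1"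
  shows "dim {w \<in> eigenspace B c. v \<bullet> w = 0} = (if c = l then 0 else dim (eigenspace B c))"
proof (cases "c = l")
  case True
  have "{w \<in> eigenspace B c. v \<bullet> w = 0} \<subseteq> {0}"
    using assms(2) unfolding True simple_eigenspace[OF assms(3,2,4)] by (auto simp: span_singleton)
  then show ?thesis
    using True by simp
next
  case False
  then have "{w \<in> eigenspace B c. v \<bullet> w = 0} = eigenspace B c"
    using symmetric_eigenvectors_orthogonal[OF assms(1,3)] by (auto simp: eigenspace_def)
  then show ?thesis
    using False by simp
qed

text \<open>
Adding \<open>t\<close> times the projection onto a simple eigenvector moves its eigenvalue from \<open>l\<close> to \<open>l + t\<close>
and leaves all other eigenspaces as they are, because they are orthogonal to \<open>v\<close>.
\<close>

lemma dim_eigenspace_rank_one_shift: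
  fixes B :: "real^'n::finite^'n"
  assumes sym: "transpose B = B" and v: "norm v = 1" "B *v v = l *\<^sub>R v"
    and simple: "dim (eigenspace B l) = 1" and t: "t \<noteq> 0" "dim (eigenspace B (l + t)) = 0"
  defines "C \<equiv> B + t *\<^sub>R (\<chi> i j. v $ i * v $ j)"
  shows "dim (eigenspace C c) = (if c = l + t then 1 else if c = l then 0 else dim (eigenspace B c))"
proof -
  have v0: "v \<noteq> 0" and vv: "v \<bullet> v = 1"
    using v(1) by (auto simp: dot_square_norm)
  have rank1: "(\<chi> i j. v $ i * v $ j) *v x = (v \<bullet> x) *\<^sub>R v" for x
    by (simp add: vec_eq_iff matrix_vector_mult_def inner_vec_def sum_distrib_left mult_ac)
  have Cx: "C *v x = B *v x + (t * (v \<bullet> x)) *\<^sub>R v" for x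
    unfolding C_def by (simp add: matrix_vector_mult_add_rdistrib scaleR_matrix_vector_assoc[symmetric] rank1)
  have symC: "transpose C = C"
    unfolding C_def by (simp add: transpose_add transpose_scaleR sym)
       (simp add: transpose_def vec_eq_iff mult.commute)
  have Cv: "C *v v = (l + t) *\<^sub>R v"
    by (simp add: Cx v(2) vv algebra_simps)
  show ?thesis
  proof (cases "c = l + t")
    case True
    have "eigenspace C c = span {v}"
    proof (intro subset_antisym subsetI)
      fix x assume x: "x \<in> eigenspace C c"
      let ?w = "x - (v \<bullet> x) *\<^sub>R v"
      have "B *v ?w = (l + t) *\<^sub>R ?w"
        using x True by (simp add: eigenspace_def Cx matrix_vector_mult_diff_distrib
            matrix_vector_mult_scaleR v(2) algebra_simps)
      then have "?w = 0"
        using t(2) unfolding dim_eigenspace_eq_0_iff by blast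
      then show "x \<in> span {v}"
        by (metis eq_iff_diff_eq_0 span_base span_scale singletonI)
    next
      fix x assume "x \<in> span {v}"
      then show "x \<in> eigenspace C c"
        using Cv True by (auto simp: span_singleton eigenspace_def matrix_vector_mult_scaleR)
    qed
    then show ?thesis
      using True v0 by (simp add: dim_insert)
  next
    case False
    have "eigenspace C c = {w \<in> eigenspace B c. v \<bullet> w = 0}"
    proof (intro subset_antisym subsetI)
      fix x assume "x \<in> eigenspace C c"
      moreover from this have "v \<bullet> x = 0"
        using symmetric_eigenvectors_orthogonal[OF symC Cv _ False[symmetric]]
        by (simp add: eigenspace_def)
      ultimately show "x \<in> {w \<in> eigenspace B c. v \<bullet> w = 0}"
        by (simp add: eigenspace_def Cx)
    qed (auto simp: eigenspace_def Cx)
    then show ?thesis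
      using False dim_eigenspace_orthogonal_part[OF sym v0 v(2) simple] by simp
  qed
qed

section \<open>Joining a weighted path to a matrix\<close>

lemma sum_UNIV_Plus:
  fixes f :: "'p::finite + 'v::finite \<Rightarrow> 'a::comm_monoid_add"
  shows "(\<Sum>i\<in>UNIV. f i) = (\<Sum>a\<in>UNIV. f (Inl a)) + (\<Sum>h\<in>UNIV. f (Inr h))"
  by (subst UNIV_Plus_UNIV[symmetric], subst sum.Plus) simp_all

definition tridiagonal :: "(nat \<Rightarrow> real) \<Rightarrow> (nat \<Rightarrow> real) \<Rightarrow> nat \<Rightarrow> nat \<Rightarrow> real" where
  "tridiagonal a b i j =
     (if i = j then a i else if j = Suc i then - b j else if i = Suc j then - b i else 0)"

lemma tridiagonal_sum:
  assumes "i < n" "\<And>k. n \<le> k \<Longrightarrow> X k = 0"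
  shows "(\<Sum>k<n. tridiagonal a b i k * X k)
           = a i * X i - (if i = 0 then 0 else b i * X (i - 1)) - b (Suc i) * X (Suc i)"
proof -
  let ?t = "\<lambda>k. (if k = i then a i * X i else 0) + (if k = i - 1 then if i = 0 then 0 else - (b i * X (i - 1)) else 0)
      + (if k = Suc i then - (b (Suc i) * X (Suc i)) else 0)"
  have "(\<Sum>k<n. tridiagonal a b i k * X k) = (\<Sum>k<n. ?t k)"
    by (intro sum.cong) (auto simp: tridiagonal_def)
  then show ?thesis
    using assms by (simp add: sum.distrib)
qed

text \<open>
A path \<open>ps\<close> with diagonal entries \<open>a k\<close> and edge entries \<open>- b k\<close> for \<open>k \<ge> 1\<close>, attached to a
symmetric matrix \<open>B\<close> at its first vertex along the vector \<open>- b 0 *\<^sub>R v\<close>.  Thus \<open>b k\<close> belongs to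
the edge that leads from the path vertex at position \<open>k\<close> back towards \<open>B\<close>.
\<close>

locale pendant_path =
  fixes ps :: "'p::finite list" and a b :: "nat \<Rightarrow> real"
    and v :: "real^'v::finite" and B :: "real^'v^'v"
  assumes distinct_ps: "distinct ps" and set_ps: "set ps = UNIV"
    and sym_B: "transpose B = B"
begin

definition pos :: "'p \<Rightarrow> nat" where
  "pos = inv_into {..<length ps} ((!) ps)"

definition joined_matrix :: "real^('p + 'v)^('p + 'v)" where
  "joined_matrix = (\<chi> i j. case i of
       Inl q \<Rightarrow> (case j of Inl r \<Rightarrow> tridiagonal a b (pos q) (pos r)
                        | Inr h \<Rightarrow> if pos q = 0 then - (b 0 * v $ h) else 0)
     | Inr h \<Rightarrow> (case j of Inl r \<Rightarrow> if pos r = 0 then - (b 0 * v $ h) else 0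
                        | Inr h' \<Rightarrow> B $ h $ h'))"

text \<open>
The coordinates of a vector along the path, continued by zero, so that the three-term recurrence
has the same form at the far end of the path.
\<close>

definition pcoord :: "real^('p + 'v) \<Rightarrow> nat \<Rightarrow> real" where
  "pcoord x k = (if k < length ps then x $ Inl (ps ! k) else 0)"

definition hpart :: "real^('p + 'v) \<Rightarrow> real^'v" where
  "hpart x = (\<chi> h. x $ Inr h)"

lemma bij_ps: "bij_betw ((!) ps) {..<length ps} UNIV"
  using bij_betw_nth[OF distinct_ps refl set_ps[symmetric]] .

lemma pos_nth: "k < length ps \<Longrightarrow> pos (ps ! k) = k"
  unfolding pos_def using bij_ps by (simp add: bij_betw_def inv_into_f_f)

lemma pos_less: "pos q < length ps" and nth_pos: "ps ! pos q = q"
  using inv_into_into[of q "(!) ps" "{..<length ps}"] f_inv_into_f[of q "(!) ps" "{..<length ps}"] bij_ps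
  by (auto simp: pos_def bij_betw_def)

lemma ps_nonempty: "0 < length ps"
  by (rule le_less_trans[OF le0 pos_less])

lemma sum_over_path: "(\<Sum>q\<in>UNIV. f q) = (\<Sum>k<length ps. f (ps ! k))"
  using sum.reindex_bij_betw[OF bij_ps, of f] by simp

lemma vector_eqI:
  assumes "\<And>k. k < length ps \<Longrightarrow> x $ Inl (ps ! k) = y $ Inl (ps ! k)" "hpart x = hpart y"
  shows "x = y"
  unfolding vec_eq_iff
proof
  fix i
  show "x $ i = y $ i"
  proof (cases i)
    case (Inl q)
    then show ?thesis using assms(1)[OF pos_less[of q]] nth_pos by simp
  next
    case (Inr h)
    then show ?thesis using assms(2) by (metis hpart_def vec_lambda_beta)
  qed
qed

lemma joined_matrix_mult_path:
  assumes "k < length ps"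
  shows "(joined_matrix *v x) $ Inl (ps ! k) = a k * pcoord x k
           - (if k = 0 then b 0 * (v \<bullet> hpart x) else b k * pcoord x (k - 1))
           - b (Suc k) * pcoord x (Suc k)"
proof -
  have "(\<Sum>q\<in>UNIV. joined_matrix $ Inl (ps ! k) $ Inl q * x $ Inl q)
      = (\<Sum>l<length ps. tridiagonal a b k l * pcoord x l)"
    unfolding sum_over_path by (intro sum.cong) (simp_all add: joined_matrix_def pos_nth assms pcoord_def)
  also have "\<dots> = a k * pcoord x k - (if k = 0 then 0 else b k * pcoord x (k - 1))
      - b (Suc k) * pcoord x (Suc k)"
    by (rule tridiagonal_sum[OF assms]) (simp add: pcoord_def)
  finally have "(\<Sum>q\<in>UNIV. joined_matrix $ Inl (ps ! k) $ Inl q * x $ Inl q) = \<dots>" .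
  moreover have "(\<Sum>h\<in>UNIV. joined_matrix $ Inl (ps ! k) $ Inr h * x $ Inr h)
      = (if k = 0 then - (b 0 * (v \<bullet> hpart x)) else 0)"
    by (simp add: joined_matrix_def pos_nth assms hpart_def inner_vec_def sum_distrib_left sum_negf mult_ac)
  ultimately show ?thesis
    by (simp add: matrix_vector_mult_def sum_UNIV_Plus)
qed

lemma joined_matrix_mult_hpart: "hpart (joined_matrix *v x) = B *v hpart x - (b 0 * pcoord x 0) *\<^sub>R v"
proof -
  have "(\<Sum>q\<in>UNIV. joined_matrix $ Inr h $ Inl q * x $ Inl q) = - (b 0 * pcoord x 0) * v $ h" for h
  proof -
    have "(\<Sum>q\<in>UNIV. joined_matrix $ Inr h $ Inl q * x $ Inl q)
        = (\<Sum>k<length ps. if k = 0 then - (b 0 * pcoord x 0) * v $ h else 0)"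
      unfolding sum_over_path by (intro sum.cong) (auto simp: joined_matrix_def pos_nth pcoord_def)
    then show ?thesis
      using ps_nonempty by simp
  qed
  then show ?thesis
    by (simp add: vec_eq_iff hpart_def matrix_vector_mult_def sum_UNIV_Plus joined_matrix_def)
qed

lemma transpose_joined_matrix: "transpose joined_matrix = joined_matrix"
  using symmetric_nth[OF sym_B]
  by (auto simp: vec_eq_iff transpose_def joined_matrix_def tridiagonal_def split: sum.split)

lemma joined_matrix_eigenvector_iff:
  "joined_matrix *v x = c *\<^sub>R x \<longleftrightarrow>
     B *v hpart x - (b 0 * pcoord x 0) *\<^sub>R v = c *\<^sub>R hpart x \<and>
     (\<forall>k<length ps. a k * pcoord x k
        - (if k = 0 then b 0 * (v \<bullet> hpart x) else b k * pcoord x (k - 1))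
        - b (Suc k) * pcoord x (Suc k) = c * pcoord x k)"
    (is "_ \<longleftrightarrow> ?R")
proof
  assume *: "joined_matrix *v x = c *\<^sub>R x"
  have "hpart (c *\<^sub>R x) = c *\<^sub>R hpart x"
    by (simp add: hpart_def vec_eq_iff)
  then show ?R
    using joined_matrix_mult_hpart[of x] joined_matrix_mult_path[of _ x] * by (auto simp: pcoord_def)
next
  assume ?R
  then show "joined_matrix *v x = c *\<^sub>R x"
    by (intro vector_eqI) (simp_all add: joined_matrix_mult_path joined_matrix_mult_hpart, simp_all add: pcoord_def hpart_def vec_eq_iff)
qed

text \<open>
Let \<open>X\<close> be supported on the non-edges of \<open>G\<close> and commute with the matrix.  The first path vertex
is adjacent to all of \<open>H\<close>, so the row of \<open>X\<close> at this vertex vanishes on \<open>H\<close>.  Hence the block of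
\<open>X\<close> on \<open>H\<close> commutes with \<open>B\<close>, and it vanishes by the SSP of \<open>B\<close>.  Now let \<open>H\<close> lie just before
position 0 of the path, and let \<open>x k l\<close> and \<open>y k h\<close> be the remaining entries of \<open>X\<close>.  The symmetry
of the product at a pair of vertices relates only entries of \<open>X\<close> whose distance along the path
differs by at most one from that of the pair.  So once all entries up to some distance are zero,
these equations give the entries at the next distance: first those between the path and \<open>H\<close>, then
those within the path, starting from its first vertex.
\<close>

lemma SSP_joined_matrix:
  assumes B: "B \<in> discrete_schrodinger H" "SSP B"
    and G: "joined_matrix \<in> discrete_schrodinger G"
    and b_pos: "\<And>k. k < length ps \<Longrightarrow> b k \<noteq> 0"
    and H_arcs: "\<And>h h'. (h, h') \<in> parcs H \<Longrightarrow> (Inr h, Inr h') \<in> parcs G"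
    and join_arcs: "\<And>h. (Inl (ps ! 0), Inr h) \<in> parcs G"
    and path_arcs: "\<And>k. Suc k < length ps \<Longrightarrow> (Inl (ps ! k), Inl (ps ! Suc k)) \<in> parcs G"
  shows "SSP joined_matrix"
  unfolding SSP_iff_nonedge_space[OF G]
proof (intro ballI impI)
  fix X assume X: "X \<in> nonedge_space G" and comm: "joined_matrix ** X = X ** joined_matrix"
  have symX: "transpose X = X"
    using X by (simp add: nonedge_space_def)
  note sX = symmetric_nth[OF symX]
  \<comment> \<open>As \<open>X\<close> is symmetric too, it commutes with the matrix exactly if their product is symmetric.\<close>
  have col: "(joined_matrix *v column j X) $ i = (joined_matrix *v column i X) $ j" for i j
  proof -
    have "transpose (joined_matrix ** X) = joined_matrix ** X"
      using comm by (simp add: matrix_transpose_mul symX transpose_joined_matrix)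
    then have "(joined_matrix ** X) $ i $ j = (joined_matrix ** X) $ j $ i"
      by (rule symmetric_nth)
    then show ?thesis
      by (simp add: matrix_matrix_mult_def matrix_vector_mult_def column_def)
  qed
  define n where "n = length ps"
  define x where "x k l = (if k < n \<and> l < n then X $ Inl (ps ! k) $ Inl (ps ! l) else 0)" for k l
  define y where "y k h = (if k < n then X $ Inl (ps ! k) $ Inr h else 0)" for k h
  have sx: "x k l = x l k" for k l
    using sX by (simp add: x_def)
  have hh: "X $ Inr h $ Inr h' = 0" for h h'
  proof -
    define Y where "Y = (\<chi> h h'. X $ Inr h $ Inr h')"
    have "X $ Inl (ps ! 0) $ Inr h = 0" for h
      using X join_arcs by (simp add: nonedge_space_def)
    then have p0: "pcoord (column (Inr h) X) 0 = 0" for h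
      by (simp add: pcoord_def column_def)
    have "(joined_matrix *v column (Inr h') X) $ Inr h = (B ** Y) $ h $ h'" for h h'
    proof -
      have "hpart (joined_matrix *v column (Inr h') X) = B *v hpart (column (Inr h') X)"
        unfolding joined_matrix_mult_hpart p0 by simp
      moreover have "hpart (column (Inr h') X) = column h' Y"
        by (simp add: hpart_def column_def Y_def)
      ultimately have "hpart (joined_matrix *v column (Inr h') X) $ h = (B *v column h' Y) $ h"
        by simp
      then show ?thesis
        by (simp add: hpart_def matrix_matrix_mult_def matrix_vector_mult_def column_def)
    qed
    then have "(B ** Y) $ h $ h' = (B ** Y) $ h' $ h" for h h'
      using col by metis
    then have "transpose (B ** Y) = B ** Y"
      by (simp add: vec_eq_iff transpose_def)
    moreover have symY: "transpose Y = Y"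
      using sX by (simp add: vec_eq_iff transpose_def Y_def)
    ultimately have "B ** Y = Y ** B"
      by (simp add: matrix_transpose_mul sym_B)
    moreover have "Y \<in> nonedge_space H"
      using symY X H_arcs by (simp add: nonedge_space_def Y_def)
    ultimately have "Y = 0"
      using B SSP_iff_nonedge_space by blast
    then have "Y $ h $ h' = 0" by simp
    then show ?thesis by (simp add: Y_def)
  qed
  have hcol_h: "hpart (column (Inr h) X) = 0" for h
    by (simp add: hpart_def column_def hh vec_eq_iff)
  have hcol_p: "hpart (column (Inl (ps ! k)) X) = (\<chi> h. y k h)" if "k < n" for k
    using that sX by (simp add: hpart_def column_def y_def)
  have pcol_h: "pcoord (column (Inr h) X) k = y k h" for h k
    by (simp add: pcoord_def column_def y_def n_def)
  have pcol_p: "pcoord (column (Inl (ps ! l)) X) k = x k l" if "l < n" for l k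
    using that by (simp add: pcoord_def column_def x_def n_def)
  have path_H: "a k * y k h - (if k = 0 then 0 else b k * y (k - 1) h) - b (Suc k) * y (Suc k) h
      = (B *v (\<chi> h. y k h)) $ h - b 0 * x 0 k * v $ h" if k: "k < n" for k h
  proof -
    have "(joined_matrix *v column (Inl (ps ! k)) X) $ Inr h = hpart (joined_matrix *v column (Inl (ps ! k)) X) $ h"
      by (simp add: hpart_def)
    then show ?thesis
      using col[of "Inr h" "Inl (ps ! k)"] joined_matrix_mult_path[of k "column (Inr h) X"] k
      unfolding joined_matrix_mult_hpart hcol_p[OF k] pcol_p[OF k] pcol_h hcol_h n_def
      by (cases "k = 0") auto
  qed
  have path_path: "a k * x k l - (if k = 0 then b 0 * (v \<bullet> (\<chi> h. y l h)) else b k * x (k - 1) l) - b (Suc k) * x (Suc k) l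
      = a l * x l k - (if l = 0 then b 0 * (v \<bullet> (\<chi> h. y k h)) else b l * x (l - 1) k) - b (Suc l) * x (Suc l) k"
    if kl: "k < n" "l < n" for k l
    using col[of "Inl (ps ! l)" "Inl (ps ! k)"] joined_matrix_mult_path[of k "column (Inl (ps ! l)) X"]
      joined_matrix_mult_path[of l "column (Inl (ps ! k)) X"] kl
    unfolding hcol_p[OF kl(1)] pcol_p[OF kl(1)] hcol_p[OF kl(2)] pcol_p[OF kl(2)] n_def by simp
  have band: "(\<forall>k\<le>d. \<forall>h. y k h = 0) \<and> (\<forall>k l. l \<le> k + Suc d \<longrightarrow> k \<le> l + Suc d \<longrightarrow> x k l = 0)" for d
  proof (induction d)
    case 0
    have "y 0 h = 0" for h
      using X join_arcs by (simp add: nonedge_space_def y_def)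
    moreover have diag: "x k k = 0" for k
      using X by (simp add: nonedge_space_def x_def)
    moreover have nxt: "x k (Suc k) = 0" for k
      using X path_arcs[of k] by (simp add: nonedge_space_def x_def n_def)
    moreover have "x k l = 0" if "l \<le> Suc k" "k \<le> Suc l" for k l
    proof -
      have "l = k \<or> l = Suc k \<or> k = Suc l"
        using that by linarith
      then show ?thesis
        using diag nxt sx by metis
    qed
    ultimately show ?case by simp
  next
    case (Suc d)
    then have y0: "y k h = 0" if "k \<le> d" for k h
      using that by blast
    have x0: "x k l = 0" if "l \<le> k + Suc d" "k \<le> l + Suc d" for k l
      using Suc that by blast
    have yd: "y (Suc d) h = 0" for h
    proof (cases "Suc d < n")
      case True
      have "(\<chi> h. y d h) = 0"
        by (simp add: y0 vec_eq_iff)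
      then have "b (Suc d) * y (Suc d) h = 0"
        using path_H[of d h] True y0[of d h] y0[of "d - 1" h] x0[of d 0]
        by (cases "d = 0") simp_all
      then show ?thesis
        using b_pos True by (simp add: n_def)
    qed (simp add: y_def)
    have far: "x (k + d + 2) k = 0" for k
    proof (induction k)
      case 0
      show ?case
      proof (cases "d + 2 < n")
        case True
        have "(\<chi> h. y (Suc d) h) = 0"
          by (simp add: yd vec_eq_iff)
        then have "b (d + 2) * x (d + 2) 0 = 0"
          using path_path[of 0 "Suc d"] True x0[of "Suc d" 0] x0[of "Suc d" 1] x0[of 0 "Suc d"] x0[of 0 d]
          by simp
        then show ?thesis
          using b_pos True by (simp add: n_def)
      qed (simp add: x_def)
    next
      case (Suc k)
      show ?case
      proof (cases "k + d + 3 < n")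
        case True
        have "b (k + d + 3) * x (k + d + 3) (Suc k) = 0"
          using path_path[of "Suc k" "k + d + 2"] True Suc sx[of k "k + d + 2"]
            x0[of "k + d + 2" "Suc k"] x0[of "k + d + 2" "k + 2"]
            x0[of "Suc k" "k + d + 2"] x0[of "Suc k" "k + d + 1"]
          by (simp add: eval_nat_numeral)
        then show ?thesis
          using b_pos True by (simp add: n_def eval_nat_numeral)
      qed (simp add: x_def)
    qed
    have "x k l = 0" if "l \<le> k + Suc (Suc d)" "k \<le> l + Suc (Suc d)" for k l
    proof -
      have "l \<le> k + Suc d \<and> k \<le> l + Suc d \<or> k = l + d + 2 \<or> l = k + d + 2"
        using that by arith
      then consider "l \<le> k + Suc d \<and> k \<le> l + Suc d" | "k = l + d + 2" | "l = k + d + 2"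
        by blast
      then show ?thesis
        using x0 far sx by cases metis+
    qed
    then show ?case
      using y0 yd by (auto simp: le_Suc_eq)
  qed
  have ph: "X $ Inl (ps ! k) $ Inr h = 0" if "k < n" for k h
  proof -
    have "y k h = 0" using band[of k] by blast
    then show ?thesis using that by (simp add: y_def)
  qed
  have pp: "X $ Inl (ps ! k) $ Inl (ps ! l) = 0" if "k < n" "l < n" for k l
  proof -
    have "x k l = 0" using band[of "k + l"] by simp
    then show ?thesis using that by (simp add: x_def)
  qed
  show "X = 0"
    unfolding vec_eq_iff
  proof (intro allI)
    fix i j
    show "X $ i $ j = 0 $ i $ j"
    proof (cases i; cases j)
      fix q r assume "i = Inl q" "j = Inl r"
      then show ?thesis using pp[of "pos q" "pos r"] pos_less nth_pos by (simp add: n_def)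
    next
      fix q h assume "i = Inl q" "j = Inr h"
      then show ?thesis using ph[of "pos q" h] pos_less nth_pos by (simp add: n_def)
    next
      fix q h assume "i = Inr h" "j = Inl q"
      then show ?thesis using ph[of "pos q" h] pos_less nth_pos sX[of i j] by (simp add: n_def)
    next
      fix h h' assume "i = Inr h" "j = Inr h'"
      then show ?thesis using hh by simp
    qed
  qed
qed

text \<open>
The vectors of \<open>H\<close> orthogonal to \<open>v\<close> form an invariant subspace on which the matrix acts as \<open>B\<close>.
Every other eigenvector is determined modulo this subspace by its component \<open>s\<close> along \<open>v\<close>: walking
down the path, the eigenvalue equations give the coordinate at position \<open>k\<close> as \<open>s\<close> times
\<open>P (Suc k)\<close> up to a nonzero factor, and the end of the path requires
\<open>P (Suc (length ps)) * s = 0\<close>.  So such an eigenvector exists exactly if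
\<open>P (Suc (length ps)) = 0\<close>, and it adds one to the dimension.
\<close>

lemma dim_eigenspace_joined_matrix:
  fixes P :: "nat \<Rightarrow> real"
  assumes v: "norm v = 1" "B *v v = \<theta> *\<^sub>R v" and simple: "dim (eigenspace B \<theta>) = 1"
    and b_pos: "\<And>k. k < length ps \<Longrightarrow> b k \<noteq> 0"
    and P: "P 0 = 1" "P 1 = c - \<theta>" "\<And>k. P (k + 2) = (c - a k) * P (k + 1) - (b k)\<^sup>2 * P k"
  shows "dim (eigenspace joined_matrix c) = (if c = \<theta> then 0 else dim (eigenspace B c))
           + (if P (Suc (length ps)) = 0 then 1 else 0)"
proof -
  define n where "n = length ps"
  have v0: "v \<noteq> 0" and vv: "v \<bullet> v = 1"
    using v(1) by (auto simp: dot_square_norm)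
  define W where "W = {w \<in> eigenspace B c. v \<bullet> w = 0}"
  define J :: "real^'v \<Rightarrow> real^('p + 'v)"
    where "J w = (\<chi> i. case i of Inl _ \<Rightarrow> 0 | Inr h \<Rightarrow> w $ h)" for w
  \<comment> \<open>The factor between the monic polynomials \<open>P\<close> and the coordinates for symmetric edge weights \<open>- b k\<close>.\<close>
  define \<pi> where "\<pi> k = (\<Prod>j\<le>k. - b j)" for k
  have \<pi>0: "\<pi> k \<noteq> 0" if "k < n" for k
    using that b_pos by (auto simp: \<pi>_def n_def)
  have \<pi>_Suc: "\<pi> (Suc k) = - b (Suc k) * \<pi> k" and \<pi>_0: "\<pi> 0 = - b 0" for k
    by (simp_all add: \<pi>_def)
  have hJ: "hpart (J w) = w" and pJ: "pcoord (J w) k = 0" for w k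
    by (simp_all add: hpart_def J_def pcoord_def vec_eq_iff)
  have linJ: "linear J"
    by (auto intro!: linearI simp: J_def vec_eq_iff split: sum.split)
  have injJ: "inj J"
    using hJ by (metis injI)
  have subW: "subspace W"
    using subspace_eigenspace[of B c]
    by (auto simp: subspace_def W_def inner_add_right)
  have dimJW: "dim (J ` W) = (if c = \<theta> then 0 else dim (eigenspace B c))"
    using dim_image_eq[OF linJ inj_on_subset[OF injJ subset_UNIV]]
      dim_eigenspace_orthogonal_part[OF sym_B v0 v(2) simple, of c] by (simp add: W_def)
  have JW: "J ` W \<subseteq> eigenspace joined_matrix c"
    by (auto simp: eigenspace_def joined_matrix_eigenvector_iff hJ pJ W_def)
  have rec: "pcoord x k * \<pi> k = P (Suc k) * (v \<bullet> hpart x)"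
    if x: "x \<in> eigenspace joined_matrix c" and "k \<le> n" for x k
    using that(2)
  proof (induction k rule: less_induct)
    case (less k)
    let ?s = "v \<bullet> hpart x"
    have ex: "B *v hpart x - (b 0 * pcoord x 0) *\<^sub>R v = c *\<^sub>R hpart x"
      and ep: "\<And>k. k < n \<Longrightarrow> a k * pcoord x k
        - (if k = 0 then b 0 * ?s else b k * pcoord x (k - 1))
        - b (Suc k) * pcoord x (Suc k) = c * pcoord x k"
      using x unfolding eigenspace_def mem_Collect_eq joined_matrix_eigenvector_iff n_def by blast+
    show ?case
    proof (cases k)
      case 0
      have "v \<bullet> (B *v hpart x) - b 0 * pcoord x 0 = c * ?s"
        using arg_cong[OF ex, of "\<lambda>u. v \<bullet> u"] by (simp add: inner_diff_right vv)
      moreover have "v \<bullet> (B *v hpart x) = \<theta> * ?s"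
        by (simp add: symmetric_inner_mult[OF sym_B] v(2))
      ultimately show ?thesis
        using 0 P(2) by (simp add: \<pi>_0 left_diff_distrib mult.commute[of "pcoord x 0"])
    next
      case (Suc l)
      have IH: "pcoord x l * \<pi> l = P (Suc l) * ?s"
        using less Suc by simp
      have "pcoord x k * \<pi> k = (- b (Suc l) * pcoord x (Suc l)) * \<pi> l"
        by (simp add: Suc \<pi>_Suc)
      also have "- b (Suc l) * pcoord x (Suc l)
          = (c - a l) * pcoord x l + (if l = 0 then b 0 * ?s else b l * pcoord x (l - 1))"
        using ep[of l] less.prems Suc by (simp add: algebra_simps)
      also have "\<dots> * \<pi> l = (c - a l) * (pcoord x l * \<pi> l)
          + (if l = 0 then b 0 * ?s else b l * pcoord x (l - 1)) * \<pi> l"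
        by (simp add: algebra_simps)
      also have "(if l = 0 then b 0 * ?s else b l * pcoord x (l - 1)) * \<pi> l = - ((b l)\<^sup>2 * P l * ?s)"
      proof (cases l)
        case 0
        then show ?thesis by (simp add: \<pi>_0 P(1) power2_eq_square)
      next
        case (Suc i)
        have "pcoord x i * \<pi> i = P (Suc i) * ?s"
          using less.IH[of i] less.prems Suc \<open>k = Suc l\<close> by simp
        then have "b l * b l * (pcoord x i * \<pi> i) = b l * b l * (P (Suc i) * ?s)"
          by simp
        then show ?thesis
          using Suc by (simp add: \<pi>_Suc power2_eq_square mult_ac)
      qed
      also have "(c - a l) * (pcoord x l * \<pi> l) + - ((b l)\<^sup>2 * P l * ?s) = P (l + 2) * ?s"
        unfolding IH P(3) by (simp add: algebra_simps)
      finally show ?thesis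
        using Suc by simp
    qed
  qed
  have in_JW: "x \<in> J ` W" if x: "x \<in> eigenspace joined_matrix c" and s: "v \<bullet> hpart x = 0" for x
  proof -
    have pc: "pcoord x k = 0" for k
    proof (cases "k < n")
      case True
      then show ?thesis using rec[OF x, of k] \<pi>0[OF True] s by simp
    qed (simp add: pcoord_def n_def)
    have "x = J (hpart x)"
    proof (rule vector_eqI)
      show "x $ Inl (ps ! k) = J (hpart x) $ Inl (ps ! k)" if "k < length ps" for k
        using pc[of k] that by (simp add: pcoord_def J_def)
    qed (simp add: hJ)
    moreover have "hpart x \<in> W"
      using x s pc[of 0] by (simp add: W_def eigenspace_def joined_matrix_eigenvector_iff)
    ultimately show ?thesis by blast
  qed
  show ?thesis
  proof (cases "P (Suc n) = 0")
    case False
    have "v \<bullet> hpart x = 0" if "x \<in> eigenspace joined_matrix c" for x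
      using rec[OF that, of n] False by (simp add: pcoord_def n_def)
    then have "eigenspace joined_matrix c = J ` W"
      using in_JW JW by blast
    then show ?thesis
      using dimJW False by (simp add: n_def)
  next
    case True
    define z :: "real^('p + 'v)"
      where "z = (\<chi> i. case i of Inl q \<Rightarrow> P (Suc (pos q)) / \<pi> (pos q) | Inr h \<Rightarrow> v $ h)"
    have hz: "hpart z = v"
      by (simp add: hpart_def z_def vec_eq_iff)
    have pz: "pcoord z k = P (Suc k) / \<pi> k" if "k < n" for k
      using that by (simp add: pcoord_def z_def pos_nth n_def)
    \<comment> \<open>At the far end of the path the left side is zero by the continuation of the coordinates, and the
      right side is zero because \<open>c\<close> is a root of the last polynomial.\<close>
    have bz: "b (Suc k) * pcoord z (Suc k) = - (P (k + 2) / \<pi> k)" if "k < n" for k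
    proof (cases "Suc k < n")
      case True
      then show ?thesis
        using \<pi>0[of "Suc k"] by (simp add: pz \<pi>_Suc)
    next
      case False
      then have "n = Suc k" using that by simp
      then show ?thesis
        using \<open>P (Suc n) = 0\<close> by (simp add: pcoord_def n_def)
    qed
    have n0: "0 < n"
      using ps_nonempty by (simp add: n_def)
    have zE: "z \<in> eigenspace joined_matrix c"
      unfolding eigenspace_def mem_Collect_eq joined_matrix_eigenvector_iff hz vv
    proof (intro conjI allI impI)
      show "B *v v - (b 0 * pcoord z 0) *\<^sub>R v = c *\<^sub>R v"
        using pz[OF n0] \<pi>0[OF n0] P(2) by (simp add: v(2) \<pi>_0 scaleR_diff_left[symmetric])
      fix k assume "k < length ps"
      then have k: "k < n" by (simp add: n_def)
      have prev: "(if k = 0 then b 0 * 1 else b k * pcoord z (k - 1)) = - ((b k)\<^sup>2 * P k / \<pi> k)"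
      proof (cases k)
        case 0
        then show ?thesis
          using \<pi>0[OF n0] by (simp add: \<pi>_0 P(1) power2_eq_square)
      next
        case (Suc i)
        then show ?thesis
          using \<pi>0[OF k] pz[of i] k by (simp add: \<pi>_Suc power2_eq_square)
      qed
      show "a k * pcoord z k - (if k = 0 then b 0 * 1 else b k * pcoord z (k - 1))
          - b (Suc k) * pcoord z (Suc k) = c * pcoord z k"
        unfolding prev bz[OF k] pz[OF k] P(3) using \<pi>0[OF k] by (simp add: field_simps)
    qed
    have "z \<notin> span (J ` W)"
    proof
      assume "z \<in> span (J ` W)"
      moreover have "span (J ` W) = J ` W"
        by (simp add: span_eq_iff linear_subspace_image[OF linJ subW])
      ultimately obtain w where w: "z = J w" "w \<in> W"
        by auto
      then have "w = v"
        using hz hJ[of w] by simp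
      then show False
        using w(2) vv by (simp add: W_def)
    qed
    moreover have "eigenspace joined_matrix c = span (insert z (J ` W))"
    proof (intro subset_antisym subsetI)
      fix x assume x: "x \<in> eigenspace joined_matrix c"
      let ?y = "x - (v \<bullet> hpart x) *\<^sub>R z"
      have "?y \<in> eigenspace joined_matrix c"
        using x zE by (intro subspace_diff subspace_scale subspace_eigenspace)
      moreover have "hpart ?y = hpart x - (v \<bullet> hpart x) *\<^sub>R v"
        unfolding hz[symmetric] by (simp add: hpart_def vec_eq_iff)
      ultimately have "?y \<in> J ` W"
        by (intro in_JW) (simp_all add: inner_diff_right vv)
      then show "x \<in> span (insert z (J ` W))"
        by (meson span_base span_breakdown_eq)
    next
      fix x assume "x \<in> span (insert z (J ` W))"
      moreover have "span (insert z (J ` W)) \<subseteq> eigenspace joined_matrix c"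
        using zE JW by (intro span_minimal subspace_eigenspace) simp
      ultimately show "x \<in> eigenspace joined_matrix c" by blast
    qed
    ultimately show ?thesis
      using dimJW True by (simp add: dim_insert n_def)
  qed
qed

lemma path_graph_arc_iff:
  "(q, r) \<in> parcs (path_graph ps) \<longleftrightarrow> pos r = Suc (pos q) \<or> pos q = Suc (pos r)"
proof
  assume "(q, r) \<in> parcs (path_graph ps)"
  then show "pos r = Suc (pos q) \<or> pos q = Suc (pos r)"
    by (auto simp: path_graph_def pos_nth)
next
  assume "pos r = Suc (pos q) \<or> pos q = Suc (pos r)"
  then have "(ps ! pos q, ps ! pos r) \<in> parcs (path_graph ps)"
    using pos_less[of q] pos_less[of r] unfolding path_graph_def pair_pre_digraph.select_convs
    by blast
  then show "(q, r) \<in> parcs (path_graph ps)"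
    by (simp add: nth_pos)
qed

lemma hd_iff_pos: "q = hd ps \<longleftrightarrow> pos q = 0"
  using ps_nonempty nth_pos[of q] pos_nth[of 0] by (auto simp: hd_conv_nth)

lemma join_at_arc_iff:
  assumes "pverts H = UNIV"
  shows "(Inl q, Inl r) \<in> parcs (join_at (path_graph ps) (hd ps) H)
           \<longleftrightarrow> pos r = Suc (pos q) \<or> pos q = Suc (pos r)"
    and "(Inl q, Inr h) \<in> parcs (join_at (path_graph ps) (hd ps) H) \<longleftrightarrow> pos q = 0"
    and "(Inr h, Inl q) \<in> parcs (join_at (path_graph ps) (hd ps) H) \<longleftrightarrow> pos q = 0"
    and "(Inr h, Inr h') \<in> parcs (join_at (path_graph ps) (hd ps) H) \<longleftrightarrow> (h, h') \<in> parcs H"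
proof -
  have "(f x, f y) \<in> map_prod f f ` S \<longleftrightarrow> (x, y) \<in> S" if "inj f" for f :: "'x \<Rightarrow> 'p + 'v" and x y S
    using that by (auto simp: inj_eq)
  note map = this[of Inl] this[of Inr]
  show "(Inl q, Inl r) \<in> parcs (join_at (path_graph ps) (hd ps) H)
      \<longleftrightarrow> pos r = Suc (pos q) \<or> pos q = Suc (pos r)"
    and "(Inr h, Inr h') \<in> parcs (join_at (path_graph ps) (hd ps) H) \<longleftrightarrow> (h, h') \<in> parcs H"
    using path_graph_arc_iff[of q r] by (auto simp: join_at_def disjoint_union_graph_def map)
  show "(Inl q, Inr h) \<in> parcs (join_at (path_graph ps) (hd ps) H) \<longleftrightarrow> pos q = 0"
    and "(Inr h, Inl q) \<in> parcs (join_at (path_graph ps) (hd ps) H) \<longleftrightarrow> pos q = 0"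
    using assms hd_iff_pos[of q] by (auto simp: join_at_def disjoint_union_graph_def)
qed

lemma joined_matrix_in_discrete_schrodinger:
  assumes B: "B \<in> discrete_schrodinger H" and verts: "pverts H = UNIV"
    and v_pos: "\<And>h. 0 < v $ h" and b_pos: "\<And>k. k < length ps \<Longrightarrow> 0 < b k"
  shows "joined_matrix \<in> discrete_schrodinger (join_at (path_graph ps) (hd ps) H)"
    (is "joined_matrix \<in> discrete_schrodinger ?G")
proof -
  have "if (i, j) \<in> parcs ?G then joined_matrix $ i $ j < 0 else joined_matrix $ i $ j = 0" if "i \<noteq> j" for i j
  proof (cases i; cases j)
    fix q r assume ij: "i = Inl q" "j = Inl r"
    then have "pos q \<noteq> pos r"
      using that nth_pos by metis
    then show ?thesis
      using ij b_pos[OF pos_less[of q]] b_pos[OF pos_less[of r]]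
      by (auto simp: joined_matrix_def join_at_arc_iff[OF verts] tridiagonal_def)
  next
    fix q h assume "i = Inl q" "j = Inr h"
    then show ?thesis
      using b_pos[OF ps_nonempty] v_pos by (simp add: joined_matrix_def join_at_arc_iff[OF verts])
  next
    fix q h assume "i = Inr h" "j = Inl q"
    then show ?thesis
      using b_pos[OF ps_nonempty] v_pos by (simp add: joined_matrix_def join_at_arc_iff[OF verts])
  next
    fix h h' assume "i = Inr h" "j = Inr h'"
    then show ?thesis
      using B that by (auto simp: joined_matrix_def join_at_arc_iff[OF verts] discrete_schrodinger_def)
  qed
  then show ?thesis
    using transpose_joined_matrix by (simp add: discrete_schrodinger_def)
qed

end

section \<open>Existence of the enlarged matrix\<close>

theorem corollary3p10:
  fixes H :: "'v::finite pair_pre_digraph"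
    and B :: "real^'v^'v"
    and lam :: "nat \<Rightarrow> real" and m :: "nat \<Rightarrow> nat" and q :: nat
    and ps :: "'p::finite list" and p :: nat
    and G :: "('p + 'v) pair_pre_digraph"
  assumes "pair_graph H" and "pverts H = UNIV" and "Digraph_Component.connected (with_proj H)"
    and "B \<in> discrete_schrodinger H" and "SSP B"
    and "1 \<le> q" and "inj_on lam {1..q}" and "\<forall>i\<in>{2..q}. lam 1 < lam i"
    and "spec B = {(lam 1, 1)} \<union> {(lam i, m i) | i. i \<in> {2..q}}"
    and "distinct ps" and "set ps = UNIV" and "length ps = p"
    and "G = join_at (path_graph ps) (hd ps) H"
    and "p \<ge> q - 1"
  shows "\<exists>A' \<in> discrete_schrodinger G. \<exists>mu :: nat \<Rightarrow> real.
           SSP A' \<and>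
           inj_on mu {1..p + 1 - q} \<and> lam ` {1..q} \<inter> mu ` {1..p + 1 - q} = {} \<and>
           spec A' = {(lam 1, 1)} \<union> {(lam i, m i + 1) | i. i \<in> {2..q}}
                       \<union> {(mu j, 1) | j. j \<in> {1..p + 1 - q}}"
proof -
  have "(lam 1, 1) \<in> spec B"
    unfolding assms(9) by simp
  then have simple: "dim (eigenspace B (lam 1)) = 1"
    by (auto simp: spec_eq)
  have mult_lam: "dim (eigenspace B (lam i)) = m i \<and> m i \<noteq> 0" if "i \<in> {2..q}" for i
  proof -
    have "(lam i, m i) \<in> spec B"
      unfolding assms(9) using that by blast
    then show ?thesis by (auto simp: spec_eq)
  qed
  have mult_other: "dim (eigenspace B c) = 0" if c: "c \<notin> lam ` {1..q}" for c
  proof (rule ccontr)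
    assume "dim (eigenspace B c) \<noteq> 0"
    then have "(c, dim (eigenspace B c)) \<in> spec B"
      by (auto simp: spec_eq)
    then show False
      using c \<open>1 \<le> q\<close> unfolding assms(9) by auto
  qed
  have split_q: "{1..q} = insert 1 {2..q}"
    using \<open>1 \<le> q\<close> by auto

  define mu :: "nat \<Rightarrow> real" where "mu j = Max (lam ` {1..q}) + real j" for j
  define N where "N = lam ` {1..q} \<union> mu ` {1..p + 1 - q}"
  have inj_mu: "inj_on mu {1..p + 1 - q}"
    by (simp add: inj_on_def mu_def)
  have lam_le: "lam i \<le> Max (lam ` {1..q})" if "i \<in> {1..q}" for i
    using that by (intro Max_ge) auto
  have disj: "lam ` {1..q} \<inter> mu ` {1..p + 1 - q} = {}"
    using lam_le by (fastforce simp: mu_def)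
  have fin: "finite N"
    by (simp add: N_def)
  have "card N = card (lam ` {1..q}) + card (mu ` {1..p + 1 - q})"
    unfolding N_def using disj by (intro card_Un_disjoint) auto
  then have cardN: "card N = Suc p"
    using card_image[OF assms(7)] card_image[OF inj_mu] \<open>p \<ge> q - 1\<close> by simp
  have p1: "1 \<le> p"
    using \<open>set ps = UNIV\<close> \<open>length ps = p\<close> by (cases ps) auto
  have lamN: "lam 1 \<in> N"
    using \<open>1 \<le> q\<close> by (simp add: N_def)
  have lam_least: "\<forall>x\<in>N. lam 1 \<le> x"
  proof -
    have "lam 1 \<le> mu j" for j
      using lam_le[of 1] \<open>1 \<le> q\<close> by (simp add: mu_def add_increasing2)
    moreover have "lam 1 \<le> lam i" if "i \<in> {1..q}" for i
      using assms(8) that unfolding split_q by (auto intro: less_imp_le)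
    ultimately show ?thesis
      unfolding N_def by blast
  qed

  \<comment> \<open>Below this distance from \<open>lam 1\<close>, a number above \<open>lam 1\<close> differs from all prescribed eigenvalues.\<close>
  define gap where "gap = Min (insert 1 ((\<lambda>x. x - lam 1) ` (N - {lam 1})))"
  have gap: "0 < gap"
    using fin lam_least unfolding gap_def by (subst Min_gr_iff) (auto simp: order_less_le)
  have gap_le: "gap \<le> x - lam 1" if "x \<in> N" "x \<noteq> lam 1" for x
    using that fin unfolding gap_def by (intro Min_le) auto

  obtain d where d: "0 < d" and perturb: "\<And>C. transpose C = C \<Longrightarrow> dist C B < d \<Longrightarrow>
      \<exists>B'\<in>discrete_schrodinger H. SSP B' \<and> (\<forall>c. dim (eigenspace B' c) = dim (eigenspace C c))"
    using SSP_perturbation[OF assms(4,5)] by blast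

  obtain x where x: "x \<noteq> 0" "B *v x = lam 1 *\<^sub>R x"
    using simple dim_eigenspace_eq_0_iff[of B "lam 1"] by auto
  define u where "u = x /\<^sub>R norm x"
  have u: "norm u = 1" "B *v u = lam 1 *\<^sub>R u"
    using x by (simp_all add: u_def matrix_vector_mult_scaleR)
  define U where "U = (\<chi> i j. u $ i * u $ j)"

  \<comment> \<open>The second bound on \<open>\<theta> - lam 1\<close> keeps \<open>B + (\<theta> - lam 1) *\<^sub>R U\<close> within distance \<open>d\<close> of \<open>B\<close>.\<close>
  have eps: "0 < min gap (d / (norm U + 1))"
    using gap d by (simp add: add_nonneg_pos)
  obtain \<alpha> \<beta> :: "nat \<Rightarrow> real" and P :: "nat \<Rightarrow> real \<Rightarrow> real"
    where theta: "lam 1 < \<alpha> 0" "\<alpha> 0 < lam 1 + min gap (d / (norm U + 1))"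
      and beta: "\<And>k. k \<le> p \<Longrightarrow> 0 < \<beta> k" and P0: "\<And>c. P 0 c = 1"
      and P_Suc: "\<And>k c. P (Suc k) c
        = (c - \<alpha> k) * P k c - (if k = 0 then 0 else (\<beta> k)\<^sup>2 * P (k - 1) c)"
      and P_last: "\<And>c. P (Suc p) c = 0 \<longleftrightarrow> c \<in> N"
    using jacobi_coefficients_exist[OF fin cardN p1 lamN lam_least eps] by blast
  define \<theta> where "\<theta> = \<alpha> 0"
  define t where "t = \<theta> - lam 1"
  have t: "0 < t" "t < gap" "t < d / (norm U + 1)"
    using theta by (auto simp: t_def \<theta>_def)
  have theta_N: "\<theta> \<notin> N"
    using gap_le[of \<theta>] t by (auto simp: t_def)
  define C where "C = B + t *\<^sub>R U"
  have "t * norm U < d"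
  proof -
    have "t * norm U \<le> t * (norm U + 1)"
      using t(1) by simp
    also have "\<dots> < d"
      using t(3) by (simp add: pos_less_divide_eq add_nonneg_pos)
    finally show ?thesis .
  qed
  then have "dist C B < d"
    using t(1) by (simp add: C_def dist_norm)
  moreover have "transpose C = C"
    using discrete_schrodinger_transpose[OF assms(4)]
    by (simp add: C_def transpose_add transpose_scaleR) (simp add: U_def transpose_def vec_eq_iff mult.commute)
  ultimately obtain B' where B': "B' \<in> discrete_schrodinger H" "SSP B'"
    and dims: "\<And>c. dim (eigenspace B' c) = dim (eigenspace C c)"
    using perturb by blast
  have "dim (eigenspace B (lam 1 + t)) = 0"
    using theta_N by (intro mult_other) (auto simp: N_def t_def)
  then have dimB': "dim (eigenspace B' c)
      = (if c = \<theta> then 1 else if c = lam 1 then 0 else dim (eigenspace B c))" for c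
    using dim_eigenspace_rank_one_shift[OF discrete_schrodinger_transpose[OF assms(4)] u simple, of t c]
      t(1) by (simp add: dims C_def U_def t_def)

  \<comment> \<open>As \<open>\<theta>\<close> is still the least eigenvalue of \<open>B'\<close>, its eigenvector can be chosen positive, and the
    entries joining \<open>H\<close> to the path are negative.\<close>
  obtain w where w: "w \<noteq> 0" "B' *v w = \<theta> *\<^sub>R w"
    using dimB'[of \<theta>] dim_eigenspace_eq_0_iff[of B' \<theta>] by auto
  have "\<theta> \<le> c" if y: "y \<noteq> 0" "B' *v y = c *\<^sub>R y" for c y
  proof (cases "c = \<theta>")
    case False
    have "dim (eigenspace B' c) \<noteq> 0"
      using y unfolding dim_eigenspace_eq_0_iff by blast
    then have "c \<noteq> lam 1" "dim (eigenspace B c) \<noteq> 0"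
      using False dimB'[of c] by metis+
    then have "c \<in> N"
      using mult_other by (auto simp: N_def)
    then show ?thesis
      using gap_le \<open>c \<noteq> lam 1\<close> t(2) by (fastforce simp: t_def)
  qed simp
  then obtain v where v: "norm v = 1" "B' *v v = \<theta> *\<^sub>R v" "\<And>i. 0 < v $ i"
    using least_eigenvalue_positive_eigenvector[OF B'(1) assms(3,2) w] by blast

  \<comment> \<open>The first coefficient \<open>\<alpha> 0 = \<theta>\<close> is the eigenvalue of \<open>B'\<close> at \<open>v\<close>, and the path carries the others.\<close>
  interpret pendant_path ps "\<lambda>k. \<alpha> (Suc k)" "\<lambda>k. \<beta> (Suc k)" v B'
    using assms(10,11) discrete_schrodinger_transpose[OF B'(1)] by unfold_locales
  have b_pos: "0 < \<beta> (Suc k)" if "k < length ps" for k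
    using beta that \<open>length ps = p\<close> by simp
  have MG: "joined_matrix \<in> discrete_schrodinger G"
    unfolding assms(13) using b_pos by (intro joined_matrix_in_discrete_schrodinger[OF B'(1) assms(2) v(3)])
  have SSPM: "SSP joined_matrix"
  proof (rule SSP_joined_matrix[OF B' MG])
    show "\<beta> (Suc k) \<noteq> 0" if "k < length ps" for k
      using b_pos[OF that] by simp
  qed (use pos_nth ps_nonempty in \<open>auto simp: assms(13) join_at_arc_iff[OF assms(2)]\<close>)
  have dimM: "dim (eigenspace joined_matrix c)
      = (if c \<in> N then 1 + (if c = lam 1 then 0 else dim (eigenspace B c)) else 0)" for c
  proof -
    have "dim (eigenspace joined_matrix c) = (if c = \<theta> then 0 else dim (eigenspace B' c))
        + (if P (Suc (length ps)) c = 0 then 1 else 0)"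
    proof (rule dim_eigenspace_joined_matrix[OF v(1,2), where P = "\<lambda>k. P k c"])
      show "dim (eigenspace B' \<theta>) = 1"
        by (simp add: dimB')
      show "\<beta> (Suc k) \<noteq> 0" if "k < length ps" for k
        using b_pos[OF that] by simp
      show "P 0 c = 1" "P 1 c = c - \<theta>"
        using P0 P_Suc[of 0 c] by (simp_all add: \<theta>_def)
      show "P (k + 2) c = (c - \<alpha> (Suc k)) * P (k + 1) c - (\<beta> (Suc k))\<^sup>2 * P k c" for k
        using P_Suc[of "Suc k" c] by simp
    qed
    moreover have "dim (eigenspace B c) = 0" if "c \<notin> N"
      using that by (intro mult_other) (auto simp: N_def)
    ultimately show ?thesis
      using theta_N lamN P_last[of c] \<open>length ps = p\<close> by (auto simp: dimB')
  qed
  define D where "D c = Suc (if c = lam 1 then 0 else dim (eigenspace B c))" for c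
  have "spec joined_matrix = (\<lambda>c. (c, D c)) ` N"
  proof -
    have "dim (eigenspace joined_matrix c) = (if c \<in> N then D c else 0)" for c
      by (simp only: dimM D_def) simp
    moreover have "D c \<noteq> 0" for c
      by (simp add: D_def)
    ultimately show ?thesis
      unfolding spec_eq by auto
  qed
  also have "\<dots> = (\<lambda>c. (c, D c)) ` lam ` {1..q} \<union> (\<lambda>c. (c, D c)) ` mu ` {1..p + 1 - q}"
    by (simp only: N_def image_Un)
  also have "(\<lambda>c. (c, D c)) ` lam ` {1..q} = {(lam 1, 1)} \<union> {(lam i, m i + 1) | i. i \<in> {2..q}}"
  proof -
    have "D (lam i) = m i + 1" if "i \<in> {2..q}" for i
    proof -
      have "lam i \<noteq> lam 1"
        using assms(8) that by (metis less_irrefl)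
      then show ?thesis
        using mult_lam[OF that] by (simp add: D_def)
    qed
    moreover have "D (lam 1) = 1"
      by (simp add: D_def)
    ultimately have "(\<lambda>c. (c, D c)) ` lam ` {1..q}
        = insert (lam 1, 1) ((\<lambda>i. (lam i, m i + 1)) ` {2..q})"
      unfolding split_q image_insert image_image by (intro arg_cong2[of _ _ _ _ insert] image_cong) simp_all
    then show ?thesis
      by blast
  qed
  also have "(\<lambda>c. (c, D c)) ` mu ` {1..p + 1 - q} = {(mu j, 1) | j. j \<in> {1..p + 1 - q}}"
  proof -
    have "D (mu j) = 1" if "j \<in> {1..p + 1 - q}" for j
    proof -
      have "mu j \<notin> lam ` {1..q}"
        using disj that by blast
      then show ?thesis
        using mult_other unfolding D_def by simp
    qed
    then have "(\<lambda>c. (c, D c)) ` mu ` {1..p + 1 - q} = (\<lambda>j. (mu j, 1)) ` {1..p + 1 - q}"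
      unfolding image_image by (intro image_cong) simp_all
    then show ?thesis
      by blast
  qed
  finally have "spec joined_matrix = {(lam 1, 1)} \<union> {(lam i, m i + 1) | i. i \<in> {2..q}}
      \<union> {(mu j, 1) | j. j \<in> {1..p + 1 - q}}" .
  then show ?thesis
    using MG SSPM inj_mu disj by blast
qed

end
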